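(* Let $\varphi$ be a nonconstant linear-fractional selfmap of the open unit disk $\mathbb{D}$, and let $\tau$ be a conformal automorphism of $\mathbb{D}$. (a) Suppose that $C_\varphi:H^2\to H^2$ is coposinormal and that $C_\psi$ is similar to $C_\varphi$ via $C_\tau$, that is, $C_\psi=(C_\tau)^{-1}C_\varphi C_\tau$. Then $C_\psi$ is also coposinormal on $H^2$. (b) Suppose that $C_\varphi:H^2\to H^2$ is posinormal and that $C_\psi$ is similar to $C_\varphi$ via $C_\tau$, that is, $C_\psi=(C_\tau)^{-1}C_\varphi C_\tau$. If $\psi$ vanishes at a point of $\mathbb{D}$, then $C_\psi$ is also posinormal on $H^2$.
   Context: $H^2$ is the Hilbert space of analytic functions $f(z)=\sum_{n\ge 0}a_nz^n$ on $\mathbb{D}$ with $\|f\|^2=\sum|a_n|^2<\infty$. For an analytic selfmap $\varphi$ of $\mathbb{D}$, $C_\varphi f=f\circ\varphi$ is the (bounded) composition operator on $H^2$; $\psi$ denotes an analytic selfmap of $\mathbb{D}$. The relation $C_\psi=(C_\tau)^{-1}C_\varphi C_\tau$ is equivalent to $\psi=\tau\circ\varphi\circ\tau^{-1}$. A bounded linear operator $A$ on a Hilbert space is posinormal if there is a positive operator $P$ with $AA^*=A^*PA$ (equivalently, $\operatorname{ran}A\subseteq\operatorname{ran}A^*$); $A$ is coposinormal if $A^*$ is posinormal. *)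

theory Defs
  imports "HOL-Complex_Analysis.Complex_Analysis"
begin

section \<open>Complex Hilbert spaces and posinormal operators\<close>

class scaleC =
  fixes scaleC :: "complex \<Rightarrow> 'a \<Rightarrow> 'a" (infixr "*\<^sub>C" 75)

text \<open>The complex inner product is linear in the first argument; its real part is the
  real inner product of \<^class>\<open>real_inner\<close>, so that norm and topology are the usual ones.\<close>

class complex_hilbert = scaleC + real_inner + complete_space +
  fixes cinner :: "'a \<Rightarrow> 'a \<Rightarrow> complex"
  assumes scaleR_eq_scaleC: "r *\<^sub>R x = complex_of_real r *\<^sub>C x"
    and scaleC_add_right: "a *\<^sub>C (x + y) = a *\<^sub>C x + a *\<^sub>C y"
    and scaleC_add_left: "(a + b) *\<^sub>C x = a *\<^sub>C x + b *\<^sub>C x"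
    and scaleC_scaleC: "a *\<^sub>C b *\<^sub>C x = (a * b) *\<^sub>C x"
    and cinner_commute: "cinner x y = cnj (cinner y x)"
    and cinner_add_left: "cinner (x + y) z = cinner x z + cinner y z"
    and cinner_scaleC_left: "cinner (a *\<^sub>C x) y = a * cinner x y"
    and inner_eq_Re_cinner: "inner x y = Re (cinner x y)"

definition bounded_clinear :: "('a::complex_hilbert \<Rightarrow> 'b::complex_hilbert) \<Rightarrow> bool" where
  "bounded_clinear A \<longleftrightarrow> bounded_linear A \<and> (\<forall>c x. A (c *\<^sub>C x) = c *\<^sub>C A x)"

text \<open>For bounded \<open>A\<close> the adjoint exists (Riesz) and is unique; cf. \<^const>\<open>adjoint\<close>
  for the real inner product.\<close>

definition cadjoint :: "('a::complex_hilbert \<Rightarrow> 'b::complex_hilbert) \<Rightarrow> 'b \<Rightarrow> 'a" where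
  "cadjoint A = (SOME B. \<forall>x y. cinner (A x) y = cinner x (B y))"

definition positive_operator :: "('a::complex_hilbert \<Rightarrow> 'a) \<Rightarrow> bool" where
  "positive_operator P \<longleftrightarrow> bounded_clinear P \<and> (\<forall>x. cinner (P x) x \<in> \<real>\<^sub>\<ge>\<^sub>0)"

definition posinormal :: "('a::complex_hilbert \<Rightarrow> 'a) \<Rightarrow> bool" where
  "posinormal A \<longleftrightarrow> bounded_clinear A \<and>
     (\<exists>P. positive_operator P \<and> A \<circ> cadjoint A = cadjoint A \<circ> P \<circ> A)"

definition coposinormal :: "('a::complex_hilbert \<Rightarrow> 'a) \<Rightarrow> bool" where
  "coposinormal A \<longleftrightarrow> bounded_clinear A \<and> posinormal (cadjoint A)"


section \<open>The Hardy space of the unit disk\<close>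

definition taylor_coeff :: "(complex \<Rightarrow> complex) \<Rightarrow> nat \<Rightarrow> complex" where
  "taylor_coeff f n = (deriv ^^ n) f 0 / fact n"

text \<open>Functions on the disk are represented by total functions that vanish outside it, so that
  equality in the type \<open>hardy\<close> is equality on the disk.\<close>

definition hardy_set :: "(complex \<Rightarrow> complex) set" where
  "hardy_set = {f. f holomorphic_on ball 0 1 \<and> (\<forall>z. z \<notin> ball 0 1 \<longrightarrow> f z = 0) \<and>
                   summable (\<lambda>n. (cmod (taylor_coeff f n))\<^sup>2)}"

lemma taylor_coeff_zero: "taylor_coeff (\<lambda>z. 0) n = 0"
  by (simp add: taylor_coeff_def)

typedef hardy = hardy_set morphisms hardy_fun Abs_hardy
proof
  show "(\<lambda>z. 0) \<in> hardy_set"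
    by (simp add: hardy_set_def taylor_coeff_zero)
qed

setup_lifting type_definition_hardy

definition hcoeff :: "hardy \<Rightarrow> nat \<Rightarrow> complex" where
  "hcoeff f = taylor_coeff (hardy_fun f)"

lemma hardy_fun_holomorphic: "hardy_fun f holomorphic_on ball 0 1"
  and hardy_fun_outside: "z \<notin> ball 0 1 \<Longrightarrow> hardy_fun f z = 0"
  and summable_hcoeff: "summable (\<lambda>n. (cmod (hcoeff f n))\<^sup>2)"
  using hardy_fun[of f] by (auto simp: hardy_set_def hcoeff_def)

lemma hardy_fun_sums:
  assumes "z \<in> ball 0 1"
  shows "(\<lambda>n. hcoeff f n * z ^ n) sums hardy_fun f z"
  using holomorphic_power_series[OF hardy_fun_holomorphic assms, of f]
  by (simp add: hcoeff_def taylor_coeff_def)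

lemma hardy_eqI:
  assumes "\<And>n. hcoeff f n = hcoeff g n"
  shows "f = g"
proof -
  have "hardy_fun f z = hardy_fun g z" for z
  proof (cases "z \<in> ball 0 1")
    case True
    show ?thesis
      using hardy_fun_sums[OF True, of f] hardy_fun_sums[OF True, of g] assms
      by (simp add: sums_unique2)
  qed (simp add: hardy_fun_outside)
  then show ?thesis
    by (metis hardy_fun_inject ext)
qed

lemma square_summable_powser:
  fixes a :: "nat \<Rightarrow> complex"
  assumes a: "summable (\<lambda>n. (cmod (a n))\<^sup>2)" and z: "z \<in> ball 0 1"
  shows "summable (\<lambda>n. a n * z ^ n)"
proof (rule summable_comparison_test)
  have "summable (\<lambda>n. (cmod z ^ 2) ^ n)"
    using z by (intro summable_geometric) (auto simp: abs_square_less_1)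
  then show "summable (\<lambda>n. (cmod (a n))\<^sup>2 + (cmod z ^ 2) ^ n)"
    by (intro summable_add a)
  have "cmod (a n * z ^ n) \<le> (cmod (a n))\<^sup>2 + (cmod z ^ 2) ^ n" for n
  proof -
    have "2 * (cmod (a n) * cmod z ^ n) \<le> (cmod (a n))\<^sup>2 + (cmod z ^ n)\<^sup>2"
      using sum_squares_bound[of "cmod (a n)" "cmod z ^ n"] by (simp add: mult.assoc)
    moreover have "0 \<le> cmod (a n) * cmod z ^ n" by simp
    ultimately have "cmod (a n) * cmod z ^ n \<le> (cmod (a n))\<^sup>2 + (cmod z ^ n)\<^sup>2" by linarith
    then show ?thesis
      by (simp add: norm_mult norm_power power_mult[symmetric] mult.commute)
  qed
  then show "\<exists>N. \<forall>n\<ge>N. norm (a n * z ^ n) \<le> (cmod (a n))\<^sup>2 + (cmod z ^ 2) ^ n"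
    by blast
qed

lemma hardy_of_coeffs:
  fixes a :: "nat \<Rightarrow> complex"
  assumes a: "summable (\<lambda>n. (cmod (a n))\<^sup>2)"
  obtains f where "hcoeff f = a"
proof -
  define F where "F = (\<lambda>z. if z \<in> ball 0 1 then \<Sum>n. a n * z ^ n else 0 :: complex)"
  have sums: "(\<lambda>n. a n * z ^ n) sums F z" if "z \<in> ball 0 1" for z
    using square_summable_powser[OF a that] that by (simp add: F_def summable_sums)
  have hol: "F holomorphic_on ball 0 1"
    using power_series_holomorphic[of 0 1 a F] sums by simp
  have "F has_fps_expansion Abs_fps a"
  proof (rule has_fps_expansionI)
    have "eventually (\<lambda>u. u \<in> ball 0 1) (nhds (0::complex))"
      by (intro eventually_nhds_in_open) auto
    then show "eventually (\<lambda>u. (\<lambda>n. fps_nth (Abs_fps a) n * u ^ n) sums F u) (nhds 0)"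
      by eventually_elim (use sums in simp)
  qed
  from fps_nth_fps_expansion[OF this] have coeff: "taylor_coeff F = a"
    by (auto simp: taylor_coeff_def fun_eq_iff)
  have "F \<in> hardy_set"
    using hol a by (simp add: hardy_set_def coeff) (simp add: F_def)
  then have "hcoeff (Abs_hardy F) = a"
    by (simp add: hcoeff_def Abs_hardy_inverse coeff)
  then show thesis by (rule that)
qed

lemma summable_square_add:
  fixes a b :: "nat \<Rightarrow> complex"
  assumes "summable (\<lambda>n. (cmod (a n))\<^sup>2)" "summable (\<lambda>n. (cmod (b n))\<^sup>2)"
  shows "summable (\<lambda>n. (cmod (a n + b n))\<^sup>2)"
proof (rule summable_comparison_test)
  show "summable (\<lambda>n. 2 * (cmod (a n))\<^sup>2 + 2 * (cmod (b n))\<^sup>2)"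
    using assms by (intro summable_add summable_mult)
  have "(cmod (a n + b n))\<^sup>2 \<le> 2 * (cmod (a n))\<^sup>2 + 2 * (cmod (b n))\<^sup>2" for n
  proof -
    have "(cmod (a n + b n))\<^sup>2 \<le> (cmod (a n) + cmod (b n))\<^sup>2"
      by (intro power_mono norm_triangle_ineq) auto
    also have "\<dots> \<le> 2 * (cmod (a n))\<^sup>2 + 2 * (cmod (b n))\<^sup>2"
      using sum_squares_bound[of "cmod (a n)" "cmod (b n)"] by (simp add: power2_sum)
    finally show ?thesis .
  qed
  then show "\<exists>N. \<forall>n\<ge>N. norm ((cmod (a n + b n))\<^sup>2) \<le> 2 * (cmod (a n))\<^sup>2 + 2 * (cmod (b n))\<^sup>2"
    by auto
qed

lemma summable_square_mult:
  fixes a :: "nat \<Rightarrow> complex"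
  assumes "summable (\<lambda>n. (cmod (a n))\<^sup>2)"
  shows "summable (\<lambda>n. (cmod (c * a n))\<^sup>2)"
  using summable_mult[OF assms, of "(cmod c)\<^sup>2"] by (simp add: norm_mult power_mult_distrib)

lemma taylor_coeff_add:
  assumes "f holomorphic_on ball 0 1" "g holomorphic_on ball 0 1"
  shows "taylor_coeff (\<lambda>z. f z + g z) n = taylor_coeff f n + taylor_coeff g n"
  using higher_deriv_add[OF assms, of 0 n] by (simp add: taylor_coeff_def add_divide_distrib)

lemma taylor_coeff_mult:
  assumes "f holomorphic_on ball 0 1"
  shows "taylor_coeff (\<lambda>z. c * f z) n = c * taylor_coeff f n"
  using higher_deriv_cmult[OF assms, of 0 n c] by (simp add: taylor_coeff_def)

lemma hardy_set_add:
  "f \<in> hardy_set \<Longrightarrow> g \<in> hardy_set \<Longrightarrow> (\<lambda>z. f z + g z) \<in> hardy_set"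
  by (auto simp: hardy_set_def taylor_coeff_add intro!: holomorphic_intros summable_square_add)

lemma hardy_set_mult: "f \<in> hardy_set \<Longrightarrow> (\<lambda>z. c * f z) \<in> hardy_set"
  by (auto simp: hardy_set_def taylor_coeff_mult intro!: holomorphic_intros summable_square_mult)

instantiation hardy :: "{zero, plus, uminus, minus, scaleC, scaleR}"
begin

lift_definition zero_hardy :: hardy is "\<lambda>z. 0"
  by (simp add: hardy_set_def taylor_coeff_zero)

lift_definition plus_hardy :: "hardy \<Rightarrow> hardy \<Rightarrow> hardy" is "\<lambda>f g z. f z + g z"
  by (rule hardy_set_add)

lift_definition scaleC_hardy :: "complex \<Rightarrow> hardy \<Rightarrow> hardy" is "\<lambda>c f z. c * f z"
  by (rule hardy_set_mult)

lift_definition uminus_hardy :: "hardy \<Rightarrow> hardy" is "\<lambda>f z. - f z"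
  using hardy_set_mult[of _ "-1"] by simp

definition minus_hardy :: "hardy \<Rightarrow> hardy \<Rightarrow> hardy" where
  "minus_hardy f g = f + - g"

definition scaleR_hardy :: "real \<Rightarrow> hardy \<Rightarrow> hardy" where
  "scaleR_hardy r f = complex_of_real r *\<^sub>C f"

instance ..

end

lemma hcoeff_zero: "hcoeff 0 n = 0"
  unfolding hcoeff_def by transfer (rule taylor_coeff_zero)

lemma hcoeff_add: "hcoeff (f + g) n = hcoeff f n + hcoeff g n"
  unfolding hcoeff_def by transfer (simp add: hardy_set_def taylor_coeff_add)

lemma hcoeff_scaleC: "hcoeff (c *\<^sub>C f) n = c * hcoeff f n"
  unfolding hcoeff_def by transfer (simp add: hardy_set_def taylor_coeff_mult)

lemma hardy_uminus_eq: "- f = (-1) *\<^sub>C (f :: hardy)"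
  by transfer simp

lemma hcoeff_uminus: "hcoeff (- f) n = - hcoeff f n"
  by (simp add: hardy_uminus_eq hcoeff_scaleC)

lemma hcoeff_minus: "hcoeff (f - g) n = hcoeff f n - hcoeff g n"
  by (simp add: minus_hardy_def hcoeff_add hcoeff_uminus)

lemma hcoeff_scaleR: "hcoeff (r *\<^sub>R f) n = complex_of_real r * hcoeff f n"
  by (simp add: scaleR_hardy_def hcoeff_scaleC)

lemmas hcoeff_simps =
  hcoeff_zero hcoeff_add hcoeff_scaleC hcoeff_uminus hcoeff_minus hcoeff_scaleR

lemma summable_hcoeff_mult: "summable (\<lambda>n. hcoeff f n * cnj (hcoeff g n))"
proof (rule summable_comparison_test)
  show "summable (\<lambda>n. (cmod (hcoeff f n))\<^sup>2 + (cmod (hcoeff g n))\<^sup>2)"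
    by (intro summable_add summable_hcoeff)
  have "cmod (hcoeff f n * cnj (hcoeff g n)) \<le> (cmod (hcoeff f n))\<^sup>2 + (cmod (hcoeff g n))\<^sup>2" for n
  proof -
    have "2 * (cmod (hcoeff f n) * cmod (hcoeff g n)) \<le> (cmod (hcoeff f n))\<^sup>2 + (cmod (hcoeff g n))\<^sup>2"
      using sum_squares_bound[of "cmod (hcoeff f n)" "cmod (hcoeff g n)"] by (simp add: mult.assoc)
    moreover have "0 \<le> cmod (hcoeff f n) * cmod (hcoeff g n)" by simp
    ultimately have "cmod (hcoeff f n) * cmod (hcoeff g n)
        \<le> (cmod (hcoeff f n))\<^sup>2 + (cmod (hcoeff g n))\<^sup>2" by linarith
    then show ?thesis by (simp add: norm_mult)
  qed
  then show "\<exists>N. \<forall>n\<ge>N. norm (hcoeff f n * cnj (hcoeff g n))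
      \<le> (cmod (hcoeff f n))\<^sup>2 + (cmod (hcoeff g n))\<^sup>2"
    by blast
qed

instantiation hardy :: real_inner
begin

definition inner_hardy :: "hardy \<Rightarrow> hardy \<Rightarrow> real" where
  "inner_hardy f g = Re (\<Sum>n. hcoeff f n * cnj (hcoeff g n))"

definition norm_hardy :: "hardy \<Rightarrow> real" where
  "norm_hardy f = sqrt (\<Sum>n. (cmod (hcoeff f n))\<^sup>2)"

definition sgn_hardy :: "hardy \<Rightarrow> hardy" where
  "sgn_hardy f = inverse (norm f) *\<^sub>R f"

definition dist_hardy :: "hardy \<Rightarrow> hardy \<Rightarrow> real" where
  "dist_hardy f g = norm (f - g)"

definition uniformity_hardy :: "(hardy \<times> hardy) filter" where
  "uniformity_hardy = (INF e\<in>{0<..}. principal {(f, g). dist f g < e})"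

definition open_hardy :: "hardy set \<Rightarrow> bool" where
  "open_hardy U \<longleftrightarrow> (\<forall>f\<in>U. eventually (\<lambda>(f', g). f' = f \<longrightarrow> g \<in> U) uniformity)"

instance
proof
  fix f g h :: hardy and r s :: real
  show "f + g + h = f + (g + h)" by (rule hardy_eqI) (simp add: hcoeff_simps)
  show "f + g = g + f" by (rule hardy_eqI) (simp add: hcoeff_simps)
  show "0 + f = f" by (rule hardy_eqI) (simp add: hcoeff_simps)
  show "- f + f = 0" by (rule hardy_eqI) (simp add: hcoeff_simps)
  show "f - g = f + - g" by (rule minus_hardy_def)
  show "r *\<^sub>R (f + g) = r *\<^sub>R f + r *\<^sub>R g" by (rule hardy_eqI) (simp add: hcoeff_simps algebra_simps)
  show "(r + s) *\<^sub>R f = r *\<^sub>R f + s *\<^sub>R f" by (rule hardy_eqI) (simp add: hcoeff_simps algebra_simps)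
  show "r *\<^sub>R s *\<^sub>R f = (r * s) *\<^sub>R f" by (rule hardy_eqI) (simp add: hcoeff_simps)
  show "1 *\<^sub>R f = f" by (rule hardy_eqI) (simp add: hcoeff_simps)
  show "sgn f = inverse (norm f) *\<^sub>R f" by (rule sgn_hardy_def)
  show "dist f g = norm (f - g)" by (rule dist_hardy_def)
  show "uniformity = (INF e\<in>{0<..}. principal {(f, g :: hardy). dist f g < e})"
    by (rule uniformity_hardy_def)
  show "open U \<longleftrightarrow> (\<forall>f\<in>U. eventually (\<lambda>(f', g). f' = f \<longrightarrow> g \<in> U) uniformity)"
    for U :: "hardy set" by (rule open_hardy_def)
  have inner_sum: "inner f g = (\<Sum>n. Re (hcoeff f n * cnj (hcoeff g n)))" for f g :: hardy
    unfolding inner_hardy_def by (rule Re_suminf[OF summable_hcoeff_mult])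
  have inner_self: "inner f f = (\<Sum>n. (cmod (hcoeff f n))\<^sup>2)" for f :: hardy
    by (simp only: inner_sum complex_norm_square[symmetric] Re_complex_of_real)
  have sm: "summable (\<lambda>n. Re (hcoeff f n * cnj (hcoeff g n)))" for f g
    using summable_hcoeff_mult[of f g] by (rule summable_Re)
  show "inner f g = inner g f"
    unfolding inner_sum by (simp add: mult.commute)
  show "inner (f + g) h = inner f h + inner g h"
    unfolding inner_sum suminf_add[OF sm sm] by (simp add: hcoeff_simps algebra_simps)
  show "inner (r *\<^sub>R f) g = r * inner f g"
    unfolding inner_sum suminf_mult[OF sm, symmetric] by (simp add: hcoeff_simps algebra_simps)
  show "0 \<le> inner f f"
    unfolding inner_self by (intro suminf_nonneg summable_hcoeff) simp
  show "inner f f = 0 \<longleftrightarrow> f = 0"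
    unfolding inner_self suminf_eq_zero_iff[OF summable_hcoeff zero_le_power2]
    by (auto simp: hcoeff_zero intro: hardy_eqI)
  show "norm f = sqrt (inner f f)"
    by (simp add: norm_hardy_def inner_self)
qed

end

lemma hardy_norm_square: "(norm f)\<^sup>2 = (\<Sum>n. (cmod (hcoeff f n))\<^sup>2)"
  by (simp add: norm_hardy_def suminf_nonneg summable_hcoeff)

lemma hardy_partial_norm: "(\<Sum>n<M. (cmod (hcoeff f n))\<^sup>2) \<le> (norm f)\<^sup>2"
  unfolding hardy_norm_square by (rule sum_le_suminf) (auto simp: summable_hcoeff)

lemma hcoeff_le_norm: "cmod (hcoeff f n) \<le> norm f"
proof -
  have "(cmod (hcoeff f n))\<^sup>2 \<le> (\<Sum>k<Suc n. (cmod (hcoeff f k))\<^sup>2)"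
    by (rule member_le_sum) auto
  also have "\<dots> \<le> (norm f)\<^sup>2" by (rule hardy_partial_norm)
  finally show ?thesis by (rule power2_le_imp_le) simp
qed

instance hardy :: complete_space
proof
  fix X :: "nat \<Rightarrow> hardy"
  assume X: "Cauchy X"
  have "convergent (\<lambda>k. hcoeff (X k) n)" for n
  proof (rule Cauchy_convergent, rule metric_CauchyI)
    fix e :: real assume "e > 0"
    with X obtain N where N: "\<And>k m. k \<ge> N \<Longrightarrow> m \<ge> N \<Longrightarrow> dist (X k) (X m) < e"
      by (meson metric_CauchyD)
    have "dist (hcoeff (X k) n) (hcoeff (X m) n) < e" if "k \<ge> N" "m \<ge> N" for k m
      using hcoeff_le_norm[of "X k - X m" n] N[OF that]
      by (simp add: dist_norm hcoeff_minus)
    then show "\<exists>N. \<forall>k\<ge>N. \<forall>m\<ge>N. dist (hcoeff (X k) n) (hcoeff (X m) n) < e" by blast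
  qed
  then obtain L where L: "\<And>n. (\<lambda>k. hcoeff (X k) n) \<longlonglongrightarrow> L n"
    unfolding convergent_def by metis
  have tail: "\<exists>N. \<forall>k\<ge>N. \<forall>M. (\<Sum>n<M. (cmod (hcoeff (X k) n - L n))\<^sup>2) \<le> e\<^sup>2" if e: "e > 0" for e
  proof -
    from X e obtain N where N: "\<And>k m. k \<ge> N \<Longrightarrow> m \<ge> N \<Longrightarrow> dist (X k) (X m) < e"
      by (meson metric_CauchyD)
    have "(\<Sum>n<M. (cmod (hcoeff (X k) n - L n))\<^sup>2) \<le> e\<^sup>2" if k: "k \<ge> N" for k M
    proof (rule LIMSEQ_le_const2)
      show "(\<lambda>m. \<Sum>n<M. (cmod (hcoeff (X k) n - hcoeff (X m) n))\<^sup>2)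
          \<longlonglongrightarrow> (\<Sum>n<M. (cmod (hcoeff (X k) n - L n))\<^sup>2)"
        by (intro tendsto_intros L)
      have "(\<Sum>n<M. (cmod (hcoeff (X k) n - hcoeff (X m) n))\<^sup>2) \<le> e\<^sup>2" if m: "m \<ge> N" for m
      proof -
        have "(\<Sum>n<M. (cmod (hcoeff (X k) n - hcoeff (X m) n))\<^sup>2) \<le> (norm (X k - X m))\<^sup>2"
          using hardy_partial_norm[of "X k - X m" M] by (simp add: hcoeff_minus)
        also have "\<dots> \<le> e\<^sup>2"
          using N[OF k m] by (intro power_mono) (auto simp: dist_norm)
        finally show ?thesis .
      qed
      then show "\<exists>N. \<forall>m\<ge>N. (\<Sum>n<M. (cmod (hcoeff (X k) n - hcoeff (X m) n))\<^sup>2) \<le> e\<^sup>2"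
        by blast
    qed
    then show ?thesis by blast
  qed
  obtain K where K: "\<And>M. (\<Sum>n<M. (cmod (hcoeff (X K) n - L n))\<^sup>2) \<le> 1\<^sup>2"
    using tail[of 1] by auto
  have "summable (\<lambda>n. (cmod (hcoeff (X K) n - L n))\<^sup>2)"
    by (rule summableI_nonneg_bounded[where x = "1\<^sup>2"]) (use K in auto)
  then have "summable (\<lambda>n. (cmod ((-1) * (hcoeff (X K) n - L n) + hcoeff (X K) n))\<^sup>2)"
    by (intro summable_square_add summable_square_mult summable_hcoeff)
  then have "summable (\<lambda>n. (cmod (L n))\<^sup>2)"
    by (simp add: algebra_simps)
  then obtain F where F: "hcoeff F = L"
    by (rule hardy_of_coeffs)
  have "X \<longlonglongrightarrow> F"
  proof (rule metric_LIMSEQ_I)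
    fix e :: real assume "e > 0"
    then obtain N where N: "\<forall>k\<ge>N. \<forall>M. (\<Sum>n<M. (cmod (hcoeff (X k) n - L n))\<^sup>2) \<le> (e/2)\<^sup>2"
      using tail[of "e/2"] by auto
    have "dist (X k) F < e" if "k \<ge> N" for k
    proof -
      have "(norm (X k - F))\<^sup>2 \<le> (e/2)\<^sup>2"
        unfolding hardy_norm_square
        using N that by (intro suminf_le_const summable_hcoeff) (auto simp: hcoeff_minus F)
      then have "norm (X k - F) \<le> e/2"
        by (rule power2_le_imp_le) (use \<open>e > 0\<close> in simp)
      then show ?thesis using \<open>e > 0\<close> by (simp add: dist_norm)
    qed
    then show "\<exists>N. \<forall>k\<ge>N. dist (X k) F < e" by blast
  qed
  then show "convergent X" by (rule convergentI)
qed

instantiation hardy :: complex_hilbert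
begin

definition cinner_hardy :: "hardy \<Rightarrow> hardy \<Rightarrow> complex" where
  "cinner_hardy f g = (\<Sum>n. hcoeff f n * cnj (hcoeff g n))"

instance
proof
  fix f g h :: hardy and r :: real and a b :: complex
  show "r *\<^sub>R f = complex_of_real r *\<^sub>C f" by (rule scaleR_hardy_def)
  show "a *\<^sub>C (f + g) = a *\<^sub>C f + a *\<^sub>C g" by (rule hardy_eqI) (simp add: hcoeff_simps algebra_simps)
  show "(a + b) *\<^sub>C f = a *\<^sub>C f + b *\<^sub>C f" by (rule hardy_eqI) (simp add: hcoeff_simps algebra_simps)
  show "a *\<^sub>C b *\<^sub>C f = (a * b) *\<^sub>C f" by (rule hardy_eqI) (simp add: hcoeff_simps)
  have "(\<lambda>n. cnj (hcoeff g n * cnj (hcoeff f n))) sums cnj (cinner g f)"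
    unfolding cinner_hardy_def sums_cnj by (rule summable_sums[OF summable_hcoeff_mult])
  then show "cinner f g = cnj (cinner g f)"
    unfolding cinner_hardy_def by (simp add: sums_iff mult.commute)
  show "cinner (f + g) h = cinner f h + cinner g h"
    unfolding cinner_hardy_def suminf_add[OF summable_hcoeff_mult summable_hcoeff_mult]
    by (simp add: hcoeff_simps algebra_simps)
  show "cinner (a *\<^sub>C f) g = a * cinner f g"
    unfolding cinner_hardy_def suminf_mult[OF summable_hcoeff_mult, symmetric]
    by (simp add: hcoeff_simps algebra_simps)
  show "inner f g = Re (cinner f g)"
    by (simp add: inner_hardy_def cinner_hardy_def)
qed

end


section \<open>Selfmaps of the disk and composition operators\<close>

definition analytic_selfmap :: "(complex \<Rightarrow> complex) \<Rightarrow> bool" where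
  "analytic_selfmap \<phi> \<longleftrightarrow> \<phi> holomorphic_on ball 0 1 \<and> \<phi> ` ball 0 1 \<subseteq> ball 0 1"

definition linear_fractional :: "(complex \<Rightarrow> complex) \<Rightarrow> bool" where
  "linear_fractional \<phi> \<longleftrightarrow>
     (\<exists>a b c d. \<forall>z\<in>ball 0 1. c * z + d \<noteq> 0 \<and> \<phi> z = (a * z + b) / (c * z + d))"

definition disk_automorphism :: "(complex \<Rightarrow> complex) \<Rightarrow> bool" where
  "disk_automorphism \<tau> \<longleftrightarrow> \<tau> holomorphic_on ball 0 1 \<and> bij_betw \<tau> (ball 0 1) (ball 0 1)"

text \<open>By Littlewood's subordination theorem \<open>f \<circ> \<phi>\<close> lies in the Hardy space for every analytic
  selfmap \<open>\<phi>\<close>, so that \<^const>\<open>Abs_hardy\<close> is only ever applied to members of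
  \<^const>\<open>hardy_set\<close> here.\<close>

definition comp_op :: "(complex \<Rightarrow> complex) \<Rightarrow> hardy \<Rightarrow> hardy" where
  "comp_op \<phi> f = Abs_hardy (\<lambda>z. if z \<in> ball 0 1 then hardy_fun f (\<phi> z) else 0)"

end

theory Submission
  imports Defs
begin

text \<open>
  Write \<open>\<phi> z = (a z + b) / (c z + d)\<close>, let \<open>\<sigma> z = (cnj a z - cnj c) / (cnj d - cnj b z)\<close> be Cowen's
  auxiliary selfmap of the disk \<open>D\<close>, and \<open>g z = 1 / (cnj d - cnj b z)\<close>, \<open>h z = c z + d\<close>. Evaluating \<open>C\<^sub>\<phi>\<close> on
  reproducing kernels gives Cowen's formula: the adjoint of \<open>C\<^sub>\<phi>\<close> sends \<open>f\<close> to \<open>g \<cdot> (T f \<circ> \<sigma>)\<close>, where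
  \<open>T\<close> is the adjoint of multiplication by \<open>h\<close>. Comparing the norms of \<open>C\<^sub>\<phi> f\<close> and of its adjoint at \<open>f\<close>
  on suitable polynomials, and conversely factoring one operator through the other, one finds that
  \<open>C\<^sub>\<phi>\<close> is coposinormal iff \<open>\<phi>(D) \<subseteq> \<sigma>(D)\<close>, that posinormality implies \<open>\<sigma>(D) \<subseteq> \<phi>(D)\<close>, and that the latter
  inclusion implies posinormality if \<open>\<phi>\<close> vanishes somewhere in \<open>D\<close>. Automorphisms commute with the
  reflection in the unit circle, so conjugation of \<open>\<phi>\<close> by \<open>\<tau>\<close> conjugates \<open>\<sigma>\<close> by \<open>\<tau>\<close>, and both inclusions
  are preserved.
\<close>

section \<open>Operators on complex Hilbert spaces\<close>

lemma cinner_add_right: "cinner x (y + z) = cinner x y + cinner (x :: 'a::complex_hilbert) z"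
  by (metis cinner_add_left cinner_commute complex_cnj_add)

lemma cinner_scaleC_right: "cinner x (a *\<^sub>C y) = cnj a * cinner (x :: 'a::complex_hilbert) y"
  by (metis cinner_scaleC_left cinner_commute complex_cnj_mult)

lemma cinner_self: "cinner x (x :: 'a::complex_hilbert) = complex_of_real ((norm x)\<^sup>2)"
proof -
  have "Im (cinner x x) = 0"
    using arg_cong[OF cinner_commute[of x x], of Im] by simp
  moreover have "Re (cinner x x) = (norm x)\<^sup>2"
    by (simp add: power2_norm_eq_inner inner_eq_Re_cinner)
  ultimately show ?thesis
    by (simp add: complex_eq_iff)
qed

lemma norm_scaleC: "norm (a *\<^sub>C (x :: 'a::complex_hilbert)) = cmod a * norm x"
proof -
  have "complex_of_real ((norm (a *\<^sub>C x))\<^sup>2) = a * cnj a * cinner x x"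
    by (simp only: cinner_self[symmetric] cinner_scaleC_left cinner_scaleC_right mult.assoc mult.left_commute)
  also have "\<dots> = complex_of_real ((cmod a * norm x)\<^sup>2)"
    by (simp only: cinner_self complex_norm_square[symmetric] power_mult_distrib of_real_mult)
  finally have "complex_of_real ((norm (a *\<^sub>C x))\<^sup>2) = complex_of_real ((cmod a * norm x)\<^sup>2)" .
  then have "(norm (a *\<^sub>C x))\<^sup>2 = (cmod a * norm x)\<^sup>2"
    by (simp only: of_real_eq_iff)
  then show ?thesis
    by (simp add: power2_eq_iff_nonneg)
qed

lemma cinner_Cauchy_Schwarz: "cmod (cinner x y) \<le> norm x * norm (y :: 'a::complex_hilbert)"
proof (cases "cinner x y = 0")
  case False
  define u where "u = cnj (sgn (cinner x y))"
  have "cmod (cinner x y) = Re (cinner (u *\<^sub>C x) y)"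
  proof -
    have "cinner (u *\<^sub>C x) y = complex_of_real (cmod (cinner x y))"
      using False by (simp add: cinner_scaleC_left u_def sgn_div_norm complex_norm_square[symmetric]
          scaleR_conv_of_real mult.commute[of "cnj _"] divide_simps
          power2_eq_square flip: of_real_mult)
    then show ?thesis by simp
  qed
  also have "\<dots> \<le> norm (u *\<^sub>C x) * norm y"
    unfolding inner_eq_Re_cinner[symmetric] by (rule norm_cauchy_schwarz)
  also have "norm (u *\<^sub>C x) = norm x"
    using False by (simp add: norm_scaleC u_def norm_sgn)
  finally show ?thesis .
qed simp

lemma cinner_eqI:
  assumes "\<And>z. cinner z x = cinner z (y :: 'a::complex_hilbert)"
  shows "x = y"
proof -
  have "inner (x - y) x = inner (x - y) y"
    by (simp add: inner_eq_Re_cinner assms)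
  then have "inner (x - y) (x - y) = 0"
    by (simp add: inner_diff_right)
  then show ?thesis
    by simp
qed

lemma bounded_clinearI:
  assumes add: "\<And>x y. A (x + y) = A x + A y"
    and scale: "\<And>c x. A (c *\<^sub>C x) = c *\<^sub>C A x"
    and bound: "\<And>x. norm (A x) \<le> K * norm x"
  shows "bounded_clinear A"
  unfolding bounded_clinear_def
  using scale bound
  by (auto intro!: bounded_linear_intro[of A K] simp: add scaleR_eq_scaleC mult.commute)

lemma bounded_clinear_bound:
  assumes "bounded_clinear A"
  obtains K where "K > 0" "\<And>x. norm (A x) \<le> K * norm x"
  using assms bounded_linear.pos_bounded[of A]
  by (auto simp: bounded_clinear_def mult.commute)

lemma bounded_clinear_compose:
  assumes "bounded_clinear A" "bounded_clinear B"
  shows "bounded_clinear (\<lambda>x. A (B x))"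
  using assms by (auto simp: bounded_clinear_def bounded_linear_compose)

section \<open>The Hardy space: kernels, shift, and adjoints\<close>

lemma hcoeff_sum: "hcoeff (\<Sum>i\<in>I. f i) n = (\<Sum>i\<in>I. hcoeff (f i) n)"
  by (induction I rule: infinite_finite_induct) (auto simp: hcoeff_simps)

lemma hardy_fun_eqI:
  assumes "\<And>z. z \<in> ball 0 1 \<Longrightarrow> hardy_fun f z = hardy_fun g z"
  shows "f = g"
proof -
  have "hardy_fun f = hardy_fun g"
    using assms hardy_fun_outside by (metis ext)
  then show ?thesis
    by (simp add: hardy_fun_inject)
qed

lemma hardy_fun_zero: "hardy_fun 0 z = 0"
  by transfer simp

lemma hardy_fun_add: "hardy_fun (f + g) z = hardy_fun f z + hardy_fun g z"
  by transfer simp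

lemma hardy_fun_scaleC: "hardy_fun (c *\<^sub>C f) z = c * hardy_fun f z"
  by transfer simp

lemma hardy_fun_minus: "hardy_fun (f - g) z = hardy_fun f z - hardy_fun g z"
  unfolding minus_hardy_def hardy_fun_add by transfer simp

lemmas hardy_fun_simps = hardy_fun_zero hardy_fun_add hardy_fun_scaleC hardy_fun_minus

definition shift :: "hardy \<Rightarrow> hardy" where
  "shift f = (SOME g. hcoeff g = case_nat 0 (hcoeff f))"

lemma hcoeff_shift: "hcoeff (shift f) = case_nat 0 (hcoeff f)"
proof -
  have "summable (\<lambda>n. (cmod (case_nat 0 (hcoeff f) n))\<^sup>2)"
    by (subst summable_Suc_iff[symmetric]) (simp add: summable_hcoeff)
  then have "\<exists>g. hcoeff g = case_nat 0 (hcoeff f)"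
    by (metis hardy_of_coeffs)
  then show ?thesis
    unfolding shift_def by (rule someI_ex)
qed

lemma hardy_fun_shift: "hardy_fun (shift f) z = z * hardy_fun f z"
proof (cases "z \<in> ball 0 1")
  case True
  have "(\<lambda>n. hcoeff (shift f) (Suc n) * z ^ Suc n) sums (z * hardy_fun f z)"
    using sums_mult[OF hardy_fun_sums[OF True, of f], of z]
    by (simp add: hcoeff_shift mult_ac)
  then have "(\<lambda>n. hcoeff (shift f) n * z ^ n) sums (z * hardy_fun f z)"
    by (subst (asm) sums_Suc_iff) (simp add: hcoeff_shift)
  then show ?thesis
    using hardy_fun_sums[OF True] sums_unique2 by blast
qed (simp add: hardy_fun_outside)

lemma cinner_shift: "cinner (shift f) (shift g) = cinner f g"
proof -
  have "(\<lambda>n. hcoeff (shift f) (Suc n) * cnj (hcoeff (shift g) (Suc n))) sums cinner f g"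
    unfolding cinner_hardy_def
    by (simp add: hcoeff_shift summable_sums summable_hcoeff_mult)
  then have "(\<lambda>n. hcoeff (shift f) n * cnj (hcoeff (shift g) n)) sums cinner f g"
    by (subst (asm) sums_Suc_iff) (simp add: hcoeff_shift)
  then show ?thesis
    unfolding cinner_hardy_def[of "shift f"] by (simp add: sums_iff)
qed

lemma norm_shift: "norm (shift f) = norm f"
proof -
  have "complex_of_real ((norm (shift f))\<^sup>2) = complex_of_real ((norm f)\<^sup>2)"
    unfolding cinner_self[symmetric] by (rule cinner_shift)
  then show ?thesis
    by (simp only: of_real_eq_iff) (simp add: power2_eq_iff_nonneg)
qed

definition szego :: "complex \<Rightarrow> hardy" where
  "szego w = (SOME g. hcoeff g = (\<lambda>n. cnj w ^ n))"

context
  fixes w :: complex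
  assumes w: "w \<in> ball 0 1"
begin

lemma hcoeff_szego: "hcoeff (szego w) n = cnj w ^ n"
proof -
  have "summable (\<lambda>n. (cmod w ^ 2) ^ n)"
    using w by (intro summable_geometric) (auto simp: abs_square_less_1)
  then have "summable (\<lambda>n. (cmod (cnj w ^ n))\<^sup>2)"
    by (simp add: norm_power power_mult[symmetric] mult.commute)
  then have "\<exists>g. hcoeff g = (\<lambda>n. cnj w ^ n)"
    by (metis hardy_of_coeffs)
  then have "hcoeff (szego w) = (\<lambda>n. cnj w ^ n)"
    unfolding szego_def by (rule someI_ex)
  then show ?thesis by simp
qed

lemma hardy_fun_szego:
  assumes "z \<in> ball 0 1"
  shows "hardy_fun (szego w) z = 1 / (1 - cnj w * z)"
proof -
  have "cmod (cnj w * z) < 1"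
    using w assms norm_mult_less[of "cnj w" 1 z 1] by simp
  then have "(\<lambda>n. hcoeff (szego w) n * z ^ n) sums (1 / (1 - cnj w * z))"
    using geometric_sums[of "cnj w * z"] by (simp add: hcoeff_szego power_mult_distrib)
  then show ?thesis
    using hardy_fun_sums[OF assms] sums_unique2 by blast
qed

lemma hardy_fun_eq_cinner: "hardy_fun f w = cinner f (szego w)"
  using hardy_fun_sums[OF w, of f] by (simp add: cinner_hardy_def hcoeff_szego sums_iff)

lemma hardy_fun_le_norm: "cmod (hardy_fun f w) \<le> norm f * norm (szego w)"
  unfolding hardy_fun_eq_cinner by (rule cinner_Cauchy_Schwarz)

end

definition hmonom :: "nat \<Rightarrow> hardy" where
  "hmonom k = (shift ^^ k) (szego 0)"

lemma hcoeff_hmonom: "hcoeff (hmonom k) n = (if n = k then 1 else 0)"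
  unfolding hmonom_def
  by (induction k arbitrary: n)
    (auto simp: hcoeff_szego hcoeff_shift power_0_left split: nat.split)

definition truncate :: "nat \<Rightarrow> hardy \<Rightarrow> hardy" where
  "truncate N f = (\<Sum>k<N. hcoeff f k *\<^sub>C hmonom k)"

lemma hcoeff_truncate: "hcoeff (truncate N f) n = (if n < N then hcoeff f n else 0)"
  by (auto simp: truncate_def hcoeff_sum hcoeff_simps hcoeff_hmonom if_distrib cong: if_cong)

lemma truncate_tendsto: "(\<lambda>N. truncate N f) \<longlonglongrightarrow> f"
proof -
  have eq: "(norm (truncate N f - f))\<^sup>2 = (\<Sum>n. (cmod (hcoeff f (n + N)))\<^sup>2)" for N
  proof -
    have "(norm (truncate N f - f))\<^sup>2 = (\<Sum>n. (cmod (hcoeff (truncate N f - f) (n + N)))\<^sup>2)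
        + (\<Sum>n<N. (cmod (hcoeff (truncate N f - f) n))\<^sup>2)"
      unfolding hardy_norm_square by (rule suminf_split_initial_segment[OF summable_hcoeff])
    then show ?thesis
      by (simp add: hcoeff_simps hcoeff_truncate)
  qed
  have "(\<lambda>N. (norm (truncate N f - f))\<^sup>2) \<longlonglongrightarrow> 0"
    unfolding eq by (rule suminf_exist_split2[OF summable_hcoeff])
  then have "(\<lambda>N. sqrt ((norm (truncate N f - f))\<^sup>2)) \<longlonglongrightarrow> sqrt 0"
    by (intro tendsto_real_sqrt)
  then have "(\<lambda>N. norm (truncate N f - f)) \<longlonglongrightarrow> 0"
    by simp
  then show ?thesis
    using Lim_null tendsto_norm_zero_iff by blast
qed

lemma cadjoint_exists:
  fixes A :: "hardy \<Rightarrow> hardy"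
  assumes A: "bounded_clinear A"
  shows "\<exists>B. \<forall>x y. cinner (A x) y = cinner x (B y)"
proof -
  interpret A: bounded_linear A
    using A by (simp add: bounded_clinear_def)
  have Ac: "A (c *\<^sub>C x) = c *\<^sub>C A x" for c x
    using A by (simp add: bounded_clinear_def)
  obtain K where K: "K > 0" "\<And>x. norm (A x) \<le> K * norm x"
    by (rule bounded_clinear_bound[OF A]) blast
  have "\<exists>b. \<forall>x. cinner (A x) y = cinner x b" for y
  proof -
    define a where "a n = cnj (cinner (A (hmonom n)) y)" for n
    have A_poly: "cinner (A (\<Sum>k<N. c k *\<^sub>C hmonom k)) y = (\<Sum>k<N. c k * cnj (a k))" for N c
    proof (induction N)
      case 0
      show ?case using cinner_add_left[of 0 0 y] by (simp add: A.zero)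
    qed (simp add: A.add cinner_add_left Ac cinner_scaleC_left a_def)
    have bound: "(\<Sum>k<N. (cmod (a k))\<^sup>2) \<le> (K * norm y)\<^sup>2" for N
    proof -
      define S where "S = (\<Sum>k<N. (cmod (a k))\<^sup>2)"
      define x where "x = (\<Sum>k<N. a k *\<^sub>C hmonom k)"
      have hx: "hcoeff x n = (if n < N then a n else 0)" for n
        by (auto simp: x_def hcoeff_sum hcoeff_simps hcoeff_hmonom if_distrib cong: if_cong)
      have "S = (norm x)\<^sup>2"
        unfolding hardy_norm_square hx S_def
        by (subst suminf_finite[of "{..<N}"]) auto
      have "complex_of_real S = cinner (A x) y"
        unfolding x_def A_poly S_def by (simp only: of_real_sum complex_norm_square)
      moreover have "0 \<le> S"
        unfolding S_def by (intro sum_nonneg zero_le_power2)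
      ultimately have "S = cmod (cinner (A x) y)"
        by (metis norm_of_real abs_of_nonneg)
      also have "\<dots> \<le> K * norm x * norm y"
        using cinner_Cauchy_Schwarz[of "A x" y] K(2)[of x]
        by (meson mult_right_mono norm_ge_zero order_trans)
      finally have le: "norm x * norm x \<le> (K * norm y) * norm x"
        using \<open>S = (norm x)\<^sup>2\<close> by (simp add: power2_eq_square mult_ac)
      have "norm x \<le> K * norm y"
      proof (cases "norm x = 0")
        case True
        then show ?thesis using K(1) by simp
      next
        case False
        then show ?thesis using le by (simp only: mult_le_cancel_right) auto
      qed
      then show ?thesis
        unfolding S_def[symmetric] \<open>S = (norm x)\<^sup>2\<close> by (intro power_mono) auto
    qed
    have "summable (\<lambda>n. (cmod (a n))\<^sup>2)"
      by (rule summableI_nonneg_bounded[where x = "(K * norm y)\<^sup>2"]) (use bound in auto)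
    then obtain b where b: "hcoeff b = a"
      by (rule hardy_of_coeffs)
    have "cinner (A x) y = cinner x b" for x
    proof -
      have "(\<lambda>N. cinner (A (truncate N x)) y) \<longlonglongrightarrow> cinner x b"
        unfolding truncate_def A_poly cinner_hardy_def[of x b] b[symmetric]
        by (rule summable_LIMSEQ[OF summable_hcoeff_mult])
      moreover have "(\<lambda>N. cinner (A (truncate N x)) y) \<longlonglongrightarrow> cinner (A x) y"
      proof -
        interpret c: bounded_linear "\<lambda>x. cinner x y"
          by (rule bounded_linear_intro[of _ "norm y"])
            (auto simp: cinner_add_left scaleR_eq_scaleC cinner_scaleC_left scaleR_conv_of_real
              intro: cinner_Cauchy_Schwarz)
        show ?thesis
          by (intro c.tendsto A.tendsto truncate_tendsto)
      qed
      ultimately show ?thesis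
        using LIMSEQ_unique by blast
    qed
    then show ?thesis by blast
  qed
  then show ?thesis by metis
qed

lemma cinner_cadjoint_right:
  fixes A :: "hardy \<Rightarrow> hardy"
  assumes "bounded_clinear A"
  shows "cinner x (cadjoint A y) = cinner (A x) y"
  unfolding cadjoint_def using someI_ex[OF cadjoint_exists[OF assms]] by metis

lemma cinner_cadjoint_left:
  fixes A :: "hardy \<Rightarrow> hardy"
  assumes "bounded_clinear A"
  shows "cinner (cadjoint A x) y = cinner x (A y)"
  by (metis assms cinner_cadjoint_right cinner_commute)

lemma cadjoint_eqI:
  fixes A :: "hardy \<Rightarrow> hardy"
  assumes "bounded_clinear A" "\<And>x y. cinner (A x) y = cinner x (B y)"
  shows "cadjoint A = B"
  by (rule ext, rule cinner_eqI) (simp add: cinner_cadjoint_right assms)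

lemma bounded_clinear_cadjoint:
  fixes A :: "hardy \<Rightarrow> hardy"
  assumes A: "bounded_clinear A"
  shows "bounded_clinear (cadjoint A)"
proof -
  obtain K where K: "K > 0" "\<And>x. norm (A x) \<le> K * norm x"
    by (rule bounded_clinear_bound[OF A]) blast
  show ?thesis
  proof (rule bounded_clinearI)
    fix x y c
    show "cadjoint A (x + y) = cadjoint A x + cadjoint A y"
      by (rule cinner_eqI) (simp add: cinner_cadjoint_right[OF A] cinner_add_right)
    show "cadjoint A (c *\<^sub>C x) = c *\<^sub>C cadjoint A x"
      by (rule cinner_eqI) (simp add: cinner_cadjoint_right[OF A] cinner_scaleC_right)
    let ?n = "norm (cadjoint A x)"
    have "?n * ?n = cmod (cinner (A (cadjoint A x)) x)"
      by (simp add: cinner_cadjoint_right[OF A, symmetric] cinner_self power2_eq_square norm_mult)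
    also have "\<dots> \<le> K * ?n * norm x"
      by (meson cinner_Cauchy_Schwarz K(2) mult_right_mono norm_ge_zero order_trans)
    finally have "?n * ?n \<le> (K * norm x) * ?n"
      by (simp add: mult_ac)
    then show "?n \<le> K * norm x"
      using K(1) by (cases "?n = 0") (auto simp: mult_le_cancel_right)
  qed
qed

lemma cadjoint_cadjoint:
  fixes A :: "hardy \<Rightarrow> hardy"
  assumes A: "bounded_clinear A"
  shows "cadjoint (cadjoint A) = A"
  by (rule cadjoint_eqI[OF bounded_clinear_cadjoint[OF A]]) (rule cinner_cadjoint_left[OF A])

text \<open>One half of Douglas' lemma for the range inclusion that defines posinormality.\<close>

lemma posinormal_norm_le:
  fixes A :: "hardy \<Rightarrow> hardy"
  assumes "posinormal A"
  obtains K where "\<And>x. norm (cadjoint A x) \<le> K * norm (A x)"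
proof -
  have A: "bounded_clinear A"
    using assms by (simp add: posinormal_def)
  obtain P where P: "bounded_clinear P" and eq: "A \<circ> cadjoint A = cadjoint A \<circ> P \<circ> A"
    using assms by (auto simp: posinormal_def positive_operator_def)
  obtain K where K: "K > 0" "\<And>x. norm (P x) \<le> K * norm x"
    by (rule bounded_clinear_bound[OF P]) blast
  have "norm (cadjoint A x) \<le> sqrt K * norm (A x)" for x
  proof -
    have "complex_of_real ((norm (cadjoint A x))\<^sup>2) = cinner (A (cadjoint A x)) x"
      unfolding cinner_self[symmetric] by (rule cinner_cadjoint_right[OF A])
    also have "A (cadjoint A x) = cadjoint A (P (A x))"
      using eq by (metis comp_apply)
    also have "cinner \<dots> x = cinner (P (A x)) (A x)"
      by (rule cinner_cadjoint_left[OF A])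
    finally have "(norm (cadjoint A x))\<^sup>2 = cmod (cinner (P (A x)) (A x))"
      by (metis abs_power2 norm_of_real)
    also have "\<dots> \<le> K * norm (A x) * norm (A x)"
      by (meson cinner_Cauchy_Schwarz K(2) mult_right_mono norm_ge_zero order_trans)
    also have "\<dots> = (sqrt K * norm (A x))\<^sup>2"
      using K(1) by (simp add: power2_eq_square mult_ac)
    finally show ?thesis
      using K(1) by (simp add: power2_le_iff_abs_le)
  qed
  then show thesis by (rule that)
qed

lemma posinormalI:
  fixes A Y :: "hardy \<Rightarrow> hardy"
  assumes A: "bounded_clinear A" and Y: "bounded_clinear Y"
    and eq: "\<And>x. A x = cadjoint A (Y x)"
  shows "posinormal A"
proof -
  have "cadjoint A x = cadjoint Y (A x)" for x
  proof (rule cinner_eqI)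
    fix z
    have "cinner z (cadjoint A x) = cinner (cadjoint A (Y z)) x"
      unfolding eq[symmetric] by (rule cinner_cadjoint_right[OF A])
    also have "\<dots> = cinner z (cadjoint Y (A x))"
      by (simp add: cinner_cadjoint_left[OF A] cinner_cadjoint_right[OF Y])
    finally show "cinner z (cadjoint A x) = cinner z (cadjoint Y (A x))" .
  qed
  then have "A (cadjoint A x) = cadjoint A (Y (cadjoint Y (A x)))" for x
    by (subst eq) simp
  then have "A \<circ> cadjoint A = cadjoint A \<circ> (\<lambda>x. Y (cadjoint Y x)) \<circ> A"
    by (simp add: fun_eq_iff)
  moreover have "positive_operator (\<lambda>x. Y (cadjoint Y x))"
    unfolding positive_operator_def
  proof (intro conjI allI)
    show "bounded_clinear (\<lambda>x. Y (cadjoint Y x))"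
      by (rule bounded_clinear_compose[OF Y bounded_clinear_cadjoint[OF Y]])
    show "cinner (Y (cadjoint Y x)) x \<in> \<real>\<^sub>\<ge>\<^sub>0" for x
      unfolding cinner_cadjoint_right[OF Y, symmetric] cinner_self by simp
  qed
  ultimately show ?thesis
    using A by (auto simp: posinormal_def)
qed

section \<open>Weighted composition operators\<close>

definition wcomp_bdd :: "(complex \<Rightarrow> complex) \<Rightarrow> (complex \<Rightarrow> complex) \<Rightarrow> bool" where
  "wcomp_bdd w s \<longleftrightarrow> (\<exists>C. \<forall>f. \<exists>v. norm v \<le> C * norm f \<and>
     (\<forall>z\<in>ball 0 1. hardy_fun v z = w z * hardy_fun f (s z)))"

lemma wcomp_bddI:
  assumes "\<And>f. \<exists>v. norm v \<le> C * norm f \<and> (\<forall>z\<in>ball 0 1. hardy_fun v z = w z * hardy_fun f (s z))"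
  shows "wcomp_bdd w s"
  using assms unfolding wcomp_bdd_def by blast

lemma wcomp_bdd_cong:
  assumes "\<And>z. z \<in> ball 0 1 \<Longrightarrow> w z = w' z" "\<And>z. z \<in> ball 0 1 \<Longrightarrow> s z = s' z"
  shows "wcomp_bdd w s \<longleftrightarrow> wcomp_bdd w' s'"
  using assms unfolding wcomp_bdd_def by simp

lemma wcomp_bdd_compose:
  assumes 1: "wcomp_bdd w1 s1" and 2: "wcomp_bdd w2 s2"
    and s1: "\<And>z. z \<in> ball 0 1 \<Longrightarrow> s1 z \<in> ball 0 1"
  shows "wcomp_bdd (\<lambda>z. w1 z * w2 (s1 z)) (\<lambda>z. s2 (s1 z))"
proof -
  obtain C1 where C1: "\<And>f. \<exists>v. norm v \<le> C1 * norm f \<and> (\<forall>z\<in>ball 0 1. hardy_fun v z = w1 z * hardy_fun f (s1 z))"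
    using 1 unfolding wcomp_bdd_def by blast
  obtain C2 where C2: "\<And>f. \<exists>v. norm v \<le> C2 * norm f \<and> (\<forall>z\<in>ball 0 1. hardy_fun v z = w2 z * hardy_fun f (s2 z))"
    using 2 unfolding wcomp_bdd_def by blast
  show ?thesis
  proof (rule wcomp_bddI)
    fix f
    obtain u where u: "norm u \<le> C2 * norm f" "\<forall>z\<in>ball 0 1. hardy_fun u z = w2 z * hardy_fun f (s2 z)"
      using C2 by blast
    obtain v where v: "norm v \<le> C1 * norm u" "\<forall>z\<in>ball 0 1. hardy_fun v z = w1 z * hardy_fun u (s1 z)"
      using C1 by blast
    have "norm v \<le> \<bar>C1\<bar> * \<bar>C2\<bar> * norm f"
    proof -
      have "norm v \<le> \<bar>C1\<bar> * norm u"
        using v(1) by (rule order_trans) (intro mult_right_mono abs_ge_self norm_ge_zero)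
      also have "\<dots> \<le> \<bar>C1\<bar> * (\<bar>C2\<bar> * norm f)"
        by (intro mult_left_mono order_trans[OF u(1)] mult_right_mono abs_ge_self norm_ge_zero abs_ge_zero)
      finally show ?thesis by (simp add: mult.assoc)
    qed
    then show "\<exists>v. norm v \<le> (\<bar>C1\<bar> * \<bar>C2\<bar>) * norm f \<and>
        (\<forall>z\<in>ball 0 1. hardy_fun v z = w1 z * w2 (s1 z) * hardy_fun f (s2 (s1 z)))"
      using u(2) v(2) s1 by (intro exI[of _ v]) (simp add: mult.assoc)
  qed
qed

lemma wcomp_bdd_weight:
  assumes "wcomp_bdd u (\<lambda>z. z)" "wcomp_bdd w s"
  shows "wcomp_bdd (\<lambda>z. u z * w z) s"
  using wcomp_bdd_compose[OF assms] by simp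

lemma wcomp_bdd_op:
  assumes "wcomp_bdd w s"
  obtains U where "bounded_clinear U"
    and "\<And>f z. z \<in> ball 0 1 \<Longrightarrow> hardy_fun (U f) z = w z * hardy_fun f (s z)"
proof -
  obtain C U where C: "\<And>f. norm (U f) \<le> C * norm f"
    and U: "\<And>f z. z \<in> ball 0 1 \<Longrightarrow> hardy_fun (U f) z = w z * hardy_fun f (s z)"
    using assms unfolding wcomp_bdd_def by metis
  have "bounded_clinear U"
    by (rule bounded_clinearI[OF _ _ C]; rule hardy_fun_eqI)
      (simp_all add: U hardy_fun_simps algebra_simps)
  then show thesis
    using U by (rule that)
qed

lemma comp_op_wcomp:
  assumes "wcomp_bdd (\<lambda>z. 1) \<phi>"
  shows "bounded_clinear (comp_op \<phi>)"
    and "z \<in> ball 0 1 \<Longrightarrow> hardy_fun (comp_op \<phi> f) z = hardy_fun f (\<phi> z)"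
proof -
  obtain U where U: "bounded_clinear U"
    and eq: "\<And>f z. z \<in> ball 0 1 \<Longrightarrow> hardy_fun (U f) z = 1 * hardy_fun f (\<phi> z)"
    using assms by (rule wcomp_bdd_op) blast
  have "comp_op \<phi> f = U f" for f
  proof -
    have "hardy_fun (U f) = (\<lambda>z. if z \<in> ball 0 1 then hardy_fun f (\<phi> z) else 0)"
      by (rule ext) (simp add: eq hardy_fun_outside)
    then show ?thesis
      by (metis comp_op_def hardy_fun_inverse)
  qed
  then have "comp_op \<phi> = U"
    by (rule ext)
  then show "bounded_clinear (comp_op \<phi>)"
    and "z \<in> ball 0 1 \<Longrightarrow> hardy_fun (comp_op \<phi> f) z = hardy_fun f (\<phi> z)"
    using U eq[of z f] by auto
qed

lemma wcomp_bdd_affine: "wcomp_bdd (\<lambda>z. a * z + b) (\<lambda>z. z)"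
proof (rule wcomp_bddI)
  fix f
  have "norm (a *\<^sub>C shift f + b *\<^sub>C f) \<le> (cmod a + cmod b) * norm f"
    using norm_triangle_ineq[of "a *\<^sub>C shift f" "b *\<^sub>C f"]
    by (simp add: norm_scaleC norm_shift algebra_simps)
  then show "\<exists>v. norm v \<le> (cmod a + cmod b) * norm f \<and>
      (\<forall>z\<in>ball 0 1. hardy_fun v z = (a * z + b) * hardy_fun f z)"
    by (intro exI[of _ "a *\<^sub>C shift f + b *\<^sub>C f"])
      (simp add: hardy_fun_simps hardy_fun_shift algebra_simps)
qed

lemma affine_shift_solvable:
  assumes cd: "cmod c < cmod d"
  obtains y where "c *\<^sub>C shift y + d *\<^sub>C y = u" "(cmod d - cmod c) * norm y \<le> norm u"
proof -
  have d: "d \<noteq> 0" using cd by auto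
  define T where "T y = (1 / d) *\<^sub>C (u - c *\<^sub>C shift y)" for y
  have contr: "dist (T x) (T y) \<le> (cmod c / cmod d) * dist x y" for x y
  proof -
    have "T x - T y = (- c / d) *\<^sub>C shift (x - y)"
      by (rule hardy_fun_eqI)
        (simp add: T_def hardy_fun_simps hardy_fun_shift d field_simps)
    then show ?thesis
      by (simp add: dist_norm norm_scaleC norm_shift norm_divide)
  qed
  have "cmod c / cmod d < 1"
    using cd d by simp
  then obtain y where y: "T y = y"
    using banach_fix_type[of "cmod c / cmod d" T] contr by auto
  have sol: "c *\<^sub>C shift y + d *\<^sub>C y = u"
  proof (rule hardy_fun_eqI)
    fix z :: complex
    have "hardy_fun y z = (1 / d) * (hardy_fun u z - c * (z * hardy_fun y z))"
      using arg_cong[OF y, of "\<lambda>f. hardy_fun f z"]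
      by (simp add: T_def hardy_fun_simps hardy_fun_shift)
    then show "hardy_fun (c *\<^sub>C shift y + d *\<^sub>C y) z = hardy_fun u z"
      using d by (simp add: hardy_fun_simps hardy_fun_shift field_simps)
  qed
  have "cmod d * norm y \<le> norm u + cmod c * norm y"
    using norm_triangle_ineq4[of u "c *\<^sub>C shift y"]
    by (simp add: sol[symmetric] norm_scaleC norm_shift)
  then show thesis
    using that[OF sol] by (simp add: algebra_simps)
qed

lemma affine_nonzero:
  assumes "cmod c < cmod d" "cmod z \<le> 1"
  shows "c * z + d \<noteq> 0"
proof
  assume "c * z + d = 0"
  then have "cmod d = cmod c * cmod z"
    by (metis add_eq_0_iff norm_minus_cancel norm_mult)
  also have "\<dots> \<le> cmod c"
    using assms(2) by (simp add: mult_left_le)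
  finally show False
    using assms(1) by simp
qed

lemma wcomp_bdd_inverse_affine:
  assumes cd: "cmod c < cmod d"
  shows "wcomp_bdd (\<lambda>z. 1 / (c * z + d)) (\<lambda>z. z)"
proof (rule wcomp_bddI)
  fix f
  obtain y where y: "c *\<^sub>C shift y + d *\<^sub>C y = f" "(cmod d - cmod c) * norm y \<le> norm f"
    using cd by (rule affine_shift_solvable)
  have "norm y \<le> 1 / (cmod d - cmod c) * norm f"
    using y(2) cd by (simp add: field_simps)
  moreover have "hardy_fun y z = 1 / (c * z + d) * hardy_fun f z" if "z \<in> ball 0 1" for z
    using affine_nonzero[OF cd, of z] that
    by (simp add: y(1)[symmetric] hardy_fun_simps hardy_fun_shift field_simps)
  ultimately show "\<exists>v. norm v \<le> 1 / (cmod d - cmod c) * norm f \<and>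
      (\<forall>z\<in>ball 0 1. hardy_fun v z = 1 / (c * z + d) * hardy_fun f z)"
    by blast
qed

definition maps_disk :: "complex \<Rightarrow> complex \<Rightarrow> complex \<Rightarrow> complex \<Rightarrow> bool" where
  "maps_disk a b c d \<longleftrightarrow> (\<forall>z\<in>ball 0 1. cmod (a * z + b) < cmod (c * z + d))"

lemma disk_ineq_closure:
  assumes "\<And>z. z \<in> ball 0 1 \<Longrightarrow> cmod (a * z + b) \<le> cmod (c * z + d)" "cmod z \<le> 1"
  shows "cmod (a * z + b) \<le> cmod (c * z + d)"
proof -
  have "closed {z. cmod (a * z + b) \<le> cmod (c * z + d)}"
    by (intro closed_Collect_le continuous_intros)
  then have "closure (ball 0 1) \<subseteq> {z. cmod (a * z + b) \<le> cmod (c * z + d)}"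
    using assms(1) by (intro closure_minimal) auto
  then show ?thesis
    using assms(2) by auto
qed

lemma disk_ineq_denominator:
  assumes le: "\<And>z. z \<in> ball 0 1 \<Longrightarrow> cmod (a * z + b) \<le> cmod (c * z + d)"
    and det: "a * d - b * c \<noteq> 0"
  shows "cmod c < cmod d"
proof (rule ccontr)
  assume "\<not> cmod c < cmod d"
  then have cd: "cmod d \<le> cmod c" by simp
  then have c: "c \<noteq> 0"
    using det by auto
  define z where "z = - d / c"
  have "cmod z \<le> 1"
    using cd c by (simp add: z_def norm_divide)
  have "cmod (a * z + b) \<le> cmod (c * z + d)"
    by (rule disk_ineq_closure[OF le \<open>cmod z \<le> 1\<close>])
  moreover have "c * z + d = 0"
    using c by (simp add: z_def)
  ultimately have "a * z + b = 0" by simp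
  moreover have "a * d - b * c = - c * (a * z + b)"
    using c by (simp add: z_def field_simps)
  ultimately show False
    using det by simp
qed

lemma maps_disk_denominator:
  assumes "maps_disk a b c d" "a * d - b * c \<noteq> 0"
  shows "cmod c < cmod d"
  by (rule disk_ineq_denominator[OF _ assms(2)])
    (use assms(1) in \<open>simp add: maps_disk_def less_imp_le\<close>)

text \<open>Von Neumann's inequality for a linear-fractional function: after expanding both squares, the
  scalar and the operator inequality have the same coefficients \<open>E\<close> and \<open>F\<close>.\<close>

lemma norm_affine_shift_le:
  assumes le: "\<And>z. z \<in> ball 0 1 \<Longrightarrow> cmod (a * z + b) \<le> cmod (c * z + d)"
  shows "norm (a *\<^sub>C shift y + b *\<^sub>C y) \<le> norm (c *\<^sub>C shift y + d *\<^sub>C y)"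
proof -
  define E where "E = (cmod c)\<^sup>2 + (cmod d)\<^sup>2 - (cmod a)\<^sup>2 - (cmod b)\<^sup>2"
  define F where "F = c * cnj d - a * cnj b"
  have sq: "(cmod (p * x + q))\<^sup>2 = (cmod p)\<^sup>2 + (cmod q)\<^sup>2 + 2 * Re (p * cnj q * x)"
    if "cmod x = 1" for p q x
  proof -
    have "(cmod (p * x + q))\<^sup>2 = (cmod (p * x))\<^sup>2 + (cmod q)\<^sup>2 + 2 * Re (p * x * cnj q)"
      unfolding cmod_power2 by (simp add: power2_eq_square algebra_simps)
    then show ?thesis
      by (simp add: norm_mult that mult_ac)
  qed
  have pos: "0 \<le> E + 2 * Re (F * x)" if x: "cmod x = 1" for x
  proof -
    have "(cmod (a * x + b))\<^sup>2 \<le> (cmod (c * x + d))\<^sup>2"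
      using disk_ineq_closure[OF le, of x] x by (intro power_mono) auto
    then show ?thesis
      unfolding sq[OF x] E_def F_def by (simp add: algebra_simps)
  qed
  have EF: "2 * cmod F \<le> E"
  proof (cases "F = 0")
    case True
    then show ?thesis using pos[of 1] by simp
  next
    case False
    have "F * - cnj (sgn F) = - complex_of_real (cmod F)"
      using False complex_norm_square[of F]
      by (simp add: sgn_div_norm scaleR_conv_of_real field_simps power2_eq_square)
    then show ?thesis
      using pos[of "- cnj (sgn F)"] False by (simp add: norm_sgn)
  qed
  have nsq: "(norm (p *\<^sub>C shift y + q *\<^sub>C y))\<^sup>2 =
      ((cmod p)\<^sup>2 + (cmod q)\<^sup>2) * (norm y)\<^sup>2 + 2 * Re (p * cnj q * cinner (shift y) y)" for p q
  proof -
    have "(norm (p *\<^sub>C shift y + q *\<^sub>C y))\<^sup>2 = (norm (p *\<^sub>C shift y))\<^sup>2 + (norm (q *\<^sub>C y))\<^sup>2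
        + 2 * inner (p *\<^sub>C shift y) (q *\<^sub>C y)"
      by (simp add: power2_norm_eq_inner inner_add_left inner_add_right inner_commute)
    then show ?thesis
      by (simp add: norm_scaleC norm_shift inner_eq_Re_cinner cinner_scaleC_left
          cinner_scaleC_right power_mult_distrib algebra_simps)
  qed
  have "- Re (F * cinner (shift y) y) \<le> cmod (F * cinner (shift y) y)"
    by (metis abs_Re_le_cmod abs_le_iff)
  also have "\<dots> \<le> cmod F * (norm y)\<^sup>2"
    using cinner_Cauchy_Schwarz[of "shift y" y]
    by (simp add: norm_mult norm_shift power2_eq_square mult_left_mono)
  finally have "0 \<le> 2 * cmod F * (norm y)\<^sup>2 + 2 * Re (F * cinner (shift y) y)"
    by simp
  also have "\<dots> \<le> E * (norm y)\<^sup>2 + 2 * Re (F * cinner (shift y) y)"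
    using EF by (intro add_right_mono mult_right_mono) auto
  also have "\<dots> = (norm (c *\<^sub>C shift y + d *\<^sub>C y))\<^sup>2 - (norm (a *\<^sub>C shift y + b *\<^sub>C y))\<^sup>2"
    unfolding nsq E_def F_def by (simp add: algebra_simps)
  finally show ?thesis
    by (simp add: power2_le_iff_abs_le)
qed

lemma linear_fractional_multiplier:
  assumes cd: "cmod c < cmod d"
    and le: "\<And>z. z \<in> ball 0 1 \<Longrightarrow> cmod (a * z + b) \<le> cmod (c * z + d)"
  obtains v where "norm v \<le> norm f"
    and "\<And>z. z \<in> ball 0 1 \<Longrightarrow> hardy_fun v z = (a * z + b) / (c * z + d) * hardy_fun f z"
proof -
  obtain y where y: "c *\<^sub>C shift y + d *\<^sub>C y = f" "(cmod d - cmod c) * norm y \<le> norm f"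
    using cd by (rule affine_shift_solvable)
  show thesis
  proof (rule that)
    show "norm (a *\<^sub>C shift y + b *\<^sub>C y) \<le> norm f"
      using norm_affine_shift_le[OF le, of y] y(1) by simp
    show "hardy_fun (a *\<^sub>C shift y + b *\<^sub>C y) z = (a * z + b) / (c * z + d) * hardy_fun f z"
      if "z \<in> ball 0 1" for z
      using affine_nonzero[OF cd, of z] that
      by (simp add: y(1)[symmetric] hardy_fun_simps hardy_fun_shift field_simps)
  qed
qed

text \<open>Littlewood's induction on the degree: \<open>\<phi> u\<close> is orthogonal to the kernel at a zero of \<open>\<phi>\<close>,
  so with the kernel as weight the constant term of \<open>f\<close> splits off orthogonally.\<close>

lemma littlewood_zero:
  assumes mult: "\<And>f. \<exists>v. norm v \<le> norm f \<and> (\<forall>z\<in>ball 0 1. hardy_fun v z = \<phi> z * hardy_fun f z)"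
    and \<phi>: "\<And>z. z \<in> ball 0 1 \<Longrightarrow> \<phi> z \<in> ball 0 1"
    and p: "p \<in> ball 0 1" "\<phi> p = 0"
  shows "wcomp_bdd (\<lambda>z. 1) \<phi>"
proof -
  define k where "k = szego p"
  define W where "W f v \<longleftrightarrow> norm v \<le> norm k * norm f \<and>
    (\<forall>z\<in>ball 0 1. hardy_fun v z = hardy_fun k z * hardy_fun f (\<phi> z))" for f v
  have poly: "\<exists>v. W f v" if "\<And>n. n \<ge> N \<Longrightarrow> hcoeff f n = 0" for N f
    using that
  proof (induction N arbitrary: f)
    case 0
    then have "f = 0"
      by (intro hardy_eqI) (simp add: hcoeff_simps)
    then show ?case
      by (intro exI[of _ 0]) (simp add: W_def hardy_fun_simps)
  next
    case (Suc N)
    have "summable (\<lambda>n. (cmod (hcoeff f (Suc n)))\<^sup>2)"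
      using summable_hcoeff[of f] by (subst summable_Suc_iff)
    then obtain g where g: "hcoeff g = (\<lambda>n. hcoeff f (Suc n))"
      by (rule hardy_of_coeffs[where a = "\<lambda>n. hcoeff f (Suc n)"])
    have f: "f = hcoeff f 0 *\<^sub>C hmonom 0 + shift g"
      by (rule hardy_eqI) (auto simp: hcoeff_simps hcoeff_hmonom hcoeff_shift g split: nat.split)
    have nf: "(norm f)\<^sup>2 = (cmod (hcoeff f 0))\<^sup>2 + (norm g)\<^sup>2"
      unfolding hardy_norm_square g
      using suminf_split_head[OF summable_hcoeff[of f]] by simp
    obtain u where u: "W g u"
      using Suc.IH[of g] Suc.prems by (auto simp: g)
    obtain v where v: "norm v \<le> norm u" "\<And>z. z \<in> ball 0 1 \<Longrightarrow> hardy_fun v z = \<phi> z * hardy_fun u z"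
      using mult by blast
    have "cinner v k = 0"
      using hardy_fun_eq_cinner[OF p(1), of v] v(2)[OF p(1)] p(2) by (simp add: k_def)
    then have "inner (hcoeff f 0 *\<^sub>C k) v = 0"
      by (subst inner_commute) (simp add: inner_eq_Re_cinner cinner_scaleC_right)
    then have "(norm (hcoeff f 0 *\<^sub>C k + v))\<^sup>2 = (norm (hcoeff f 0 *\<^sub>C k))\<^sup>2 + (norm v)\<^sup>2"
      by (simp add: power2_norm_eq_inner inner_add_left inner_add_right inner_commute)
    also have "\<dots> \<le> (cmod (hcoeff f 0) * norm k)\<^sup>2 + (norm k * norm g)\<^sup>2"
      using v(1) u by (intro add_mono power_mono) (auto simp: norm_scaleC W_def)
    also have "\<dots> = (norm k * norm f)\<^sup>2"
      by (simp add: power_mult_distrib nf algebra_simps)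
    finally have "norm (hcoeff f 0 *\<^sub>C k + v) \<le> norm k * norm f"
      by (rule power2_le_imp_le) simp
    moreover have "hardy_fun (hcoeff f 0 *\<^sub>C k + v) z = hardy_fun k z * hardy_fun f (\<phi> z)"
      if z: "z \<in> ball 0 1" for z
    proof -
      have "hardy_fun f (\<phi> z) = hcoeff f 0 + \<phi> z * hardy_fun g (\<phi> z)"
        using \<phi>[OF z] by (subst f)
          (simp add: hardy_fun_simps hardy_fun_shift hmonom_def hardy_fun_szego)
      then show ?thesis
        using u z v(2)[OF z] by (simp add: W_def hardy_fun_simps algebra_simps)
    qed
    ultimately show ?case
      unfolding W_def by blast
  qed
  have "wcomp_bdd (hardy_fun k) \<phi>"
  proof (rule wcomp_bddI)
    fix f
    have diff: "\<exists>v. W (truncate N f - truncate M f) v" for M N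
      by (rule poly[of "max M N"]) (simp add: hcoeff_simps hcoeff_truncate)
    have "\<exists>v. W (truncate N f) v" for N
      by (rule poly[of N]) (simp add: hcoeff_truncate)
    then obtain X where X: "\<And>N. W (truncate N f) (X N)"
      by metis
    have dX: "norm (X N - X M) \<le> norm k * norm (truncate N f - truncate M f)" for M N
    proof -
      obtain v where v: "W (truncate N f - truncate M f) v"
        using diff by blast
      have "X N - X M = v"
        by (rule hardy_fun_eqI) (use X[of N] X[of M] v in \<open>simp add: W_def hardy_fun_simps algebra_simps\<close>)
      then show ?thesis
        using v by (simp add: W_def)
    qed
    have "Cauchy X"
    proof (rule metric_CauchyI)
      fix e :: real assume e: "e > 0"
      have pos: "0 < e / (norm k + 1)"
        using e by (intro divide_pos_pos) (auto intro: add_nonneg_pos)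
      have "Cauchy (\<lambda>N. truncate N f)"
        using truncate_tendsto by (rule LIMSEQ_imp_Cauchy)
      then obtain K where K: "\<And>m n. m \<ge> K \<Longrightarrow> n \<ge> K \<Longrightarrow> dist (truncate m f) (truncate n f) < e / (norm k + 1)"
        using pos by (meson metric_CauchyD)
      have "dist (X m) (X n) < e" if "m \<ge> K" "n \<ge> K" for m n
      proof -
        let ?t = "dist (truncate m f) (truncate n f)"
        have "dist (X m) (X n) \<le> norm k * ?t"
          using dX by (simp add: dist_norm)
        also have "\<dots> \<le> (norm k + 1) * ?t"
          by (intro mult_right_mono) auto
        also have "\<dots> < e"
          using K[OF that] pos_less_divide_eq[of "norm k + 1" ?t e]
          by (simp add: add_nonneg_pos mult.commute)
        finally show ?thesis .
      qed
      then show "\<exists>K. \<forall>m\<ge>K. \<forall>n\<ge>K. dist (X m) (X n) < e" by blast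
    qed
    then obtain v where v: "X \<longlonglongrightarrow> v"
      using Cauchy_convergent convergent_def by blast
    have point: "(\<lambda>N. hardy_fun (Y N) z) \<longlonglongrightarrow> hardy_fun y z"
      if "z \<in> ball 0 1" "Y \<longlonglongrightarrow> y" for Y y z
    proof (subst Lim_null, rule Lim_null_comparison)
      show "\<forall>\<^sub>F N in sequentially. norm (hardy_fun (Y N) z - hardy_fun y z) \<le> norm (Y N - y) * norm (szego z)"
        using hardy_fun_le_norm[OF that(1)] by (simp flip: hardy_fun_minus)
      show "(\<lambda>N. norm (Y N - y) * norm (szego z)) \<longlonglongrightarrow> 0"
        using that(2) by (intro tendsto_mult_left_zero tendsto_norm_zero) (simp add: LIM_zero)
    qed
    have "norm v \<le> norm k * norm f"
      by (rule LIMSEQ_le[OF tendsto_norm[OF v] tendsto_mult_left[OF tendsto_norm[OF truncate_tendsto]]])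
        (use X in \<open>auto simp: W_def\<close>)
    moreover have "hardy_fun v z = hardy_fun k z * hardy_fun f (\<phi> z)" if z: "z \<in> ball 0 1" for z
    proof (rule LIMSEQ_unique)
      show "(\<lambda>N. hardy_fun (X N) z) \<longlonglongrightarrow> hardy_fun v z"
        by (rule point[OF z v])
      have "(\<lambda>N. hardy_fun k z * hardy_fun (truncate N f) (\<phi> z)) \<longlonglongrightarrow> hardy_fun k z * hardy_fun f (\<phi> z)"
        by (intro tendsto_mult_left point \<phi> z truncate_tendsto)
      then show "(\<lambda>N. hardy_fun (X N) z) \<longlonglongrightarrow> hardy_fun k z * hardy_fun f (\<phi> z)"
        using X z by (simp add: W_def)
    qed
    ultimately show "\<exists>v. norm v \<le> norm k * norm f \<and>
        (\<forall>z\<in>ball 0 1. hardy_fun v z = hardy_fun k z * hardy_fun f (\<phi> z))"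
      by blast
  qed
  then have "wcomp_bdd (\<lambda>z. (- cnj p * z + 1) * hardy_fun k z) \<phi>"
    by (rule wcomp_bdd_weight[OF wcomp_bdd_affine])
  moreover have "(- cnj p * z + 1) * hardy_fun k z = 1" if "z \<in> ball 0 1" for z
    using affine_nonzero[of "- cnj p" 1 z] p(1) that
    by (simp add: k_def hardy_fun_szego[OF p(1) that] field_simps)
  ultimately show ?thesis
    using wcomp_bdd_cong[of "\<lambda>z. (- cnj p * z + 1) * hardy_fun k z" "\<lambda>z. 1" \<phi> \<phi>] by simp
qed

lemma blaschke_identity:
  "(cmod (v - cnj q * u))\<^sup>2 - (cmod (u - q * v))\<^sup>2 = (1 - (cmod q)\<^sup>2) * ((cmod v)\<^sup>2 - (cmod u)\<^sup>2)"
  unfolding cmod_power2 by (simp add: power2_eq_square algebra_simps)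

lemma blaschke_less:
  assumes "cmod q < 1" "cmod u < cmod v"
  shows "cmod (u - q * v) < cmod (v - cnj q * u)"
proof -
  have "0 < (1 - (cmod q)\<^sup>2) * ((cmod v)\<^sup>2 - (cmod u)\<^sup>2)"
    using assms by (intro mult_pos_pos) (auto simp: abs_square_less_1 power_strict_mono)
  then have "(cmod (u - q * v))\<^sup>2 < (cmod (v - cnj q * u))\<^sup>2"
    unfolding blaschke_identity[symmetric] by simp
  then show ?thesis
    by (rule power2_less_imp_less) simp
qed

lemma maps_disk_zero_bdd:
  assumes m: "maps_disk a b c d" "cmod c < cmod d" and p: "p \<in> ball 0 1" "a * p + b = 0"
  shows "wcomp_bdd (\<lambda>z. 1) (\<lambda>z. (a * z + b) / (c * z + d))"
proof (rule littlewood_zero[OF _ _ p(1)])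
  show "\<exists>v. norm v \<le> norm f \<and> (\<forall>z\<in>ball 0 1. hardy_fun v z = (a * z + b) / (c * z + d) * hardy_fun f z)" for f
    using linear_fractional_multiplier[OF m(2), of a b f] m(1)
    by (metis maps_disk_def less_imp_le)
  show "(a * z + b) / (c * z + d) \<in> ball 0 1" if "z \<in> ball 0 1" for z
    using m(1) that by (auto simp: maps_disk_def norm_divide divide_simps)
qed (simp add: p(2))

lemma maps_disk_bdd:
  assumes m: "maps_disk a b c d" and det: "a * d - b * c \<noteq> 0"
  shows "wcomp_bdd (\<lambda>z. 1) (\<lambda>z. (a * z + b) / (c * z + d))"
proof -
  have cd: "cmod c < cmod d"
    using m det by (rule maps_disk_denominator)
  then have d: "d \<noteq> 0" by auto
  define q where "q = b / d"
  have q: "cmod q < 1"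
    using bspec[OF m[unfolded maps_disk_def], of 0] by (simp add: q_def norm_divide divide_simps)
  have b: "b - q * d = 0"
    using d by (simp add: q_def)
  define a' c' d' where "a' = a - q * c" and "c' = c - cnj q * a" and "d' = d - cnj q * b"
  have m': "maps_disk a' 0 c' d'"
    unfolding maps_disk_def
  proof
    fix z :: complex assume z: "z \<in> ball 0 1"
    have "cmod ((a * z + b) - q * (c * z + d)) < cmod ((c * z + d) - cnj q * (a * z + b))"
      using m z by (intro blaschke_less q) (simp add: maps_disk_def)
    moreover have "(a * z + b) - q * (c * z + d) = a' * z + 0"
      using b by (simp add: a'_def algebra_simps)
    moreover have "(c * z + d) - cnj q * (a * z + b) = c' * z + d'"
      by (simp add: c'_def d'_def algebra_simps)
    ultimately show "cmod (a' * z + 0) < cmod (c' * z + d')"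
      by simp
  qed
  have "a' * d' - 0 * c' = (a * d - b * c) * (1 - q * cnj q) + (b - q * d) * (c - cnj q * a)"
    by (simp add: a'_def c'_def d'_def algebra_simps)
  moreover have "1 - q * cnj q \<noteq> 0"
  proof
    assume "1 - q * cnj q = 0"
    then have "complex_of_real ((cmod q)\<^sup>2) = complex_of_real 1"
      by (simp only: complex_norm_square) simp
    then have "(cmod q)\<^sup>2 = 1"
      by (simp only: of_real_eq_iff)
    with q show False
      by (simp add: abs_square_eq_1)
  qed
  ultimately have det': "a' * d' - 0 * c' \<noteq> 0"
    using det b by simp
  have cd': "cmod c' < cmod d'"
    using m' det' by (rule maps_disk_denominator)
  have 1: "wcomp_bdd (\<lambda>z. 1) (\<lambda>z. (a' * z + 0) / (c' * z + d'))"
    by (rule maps_disk_zero_bdd[OF m' cd', of 0]) auto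
  have mq: "maps_disk 1 q (cnj q) 1"
    unfolding maps_disk_def using blaschke_less[of "-q" _ 1] q
    by (auto simp: add.commute)
  have 2: "wcomp_bdd (\<lambda>z. 1) (\<lambda>z. (1 * z + q) / (cnj q * z + 1))"
    by (rule maps_disk_zero_bdd[OF mq, of "-q"]) (use q in auto)
  have "wcomp_bdd (\<lambda>z. 1 * 1)
      (\<lambda>z. (1 * ((a' * z + 0) / (c' * z + d')) + q) / (cnj q * ((a' * z + 0) / (c' * z + d')) + 1))"
    using m' by (intro wcomp_bdd_compose[OF 1 2])
      (auto simp: maps_disk_def norm_divide divide_simps)
  moreover have "(1 * ((a' * z + 0) / (c' * z + d')) + q) / (cnj q * ((a' * z + 0) / (c' * z + d')) + 1)
      = (a * z + b) / (c * z + d)" if z: "z \<in> ball 0 1" for z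
  proof -
    have nz: "c' * z + d' \<noteq> 0" "c * z + d \<noteq> 0"
      using affine_nonzero[OF cd, of z] affine_nonzero[OF cd', of z] z by auto
    have "(a' * z + 0) + q * (c' * z + d') = (1 - q * cnj q) * (a * z + b) - (b - q * d)"
      by (simp add: a'_def c'_def d'_def algebra_simps)
    then have num: "(a' * z + 0) + q * (c' * z + d') = (1 - q * cnj q) * (a * z + b)"
      using b by simp
    have "cnj q * (a' * z + 0) + (c' * z + d') = (1 - q * cnj q) * (c * z + d) - cnj q * (b - q * d)"
      by (simp add: a'_def c'_def d'_def algebra_simps)
    then have den: "cnj q * (a' * z + 0) + (c' * z + d') = (1 - q * cnj q) * (c * z + d)"
      using b by simp
    have "(1 * ((a' * z + 0) / (c' * z + d')) + q) / (cnj q * ((a' * z + 0) / (c' * z + d')) + 1)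
       = ((a' * z + 0) + q * (c' * z + d')) / (cnj q * (a' * z + 0) + (c' * z + d'))"
      using nz(1) by (simp add: divide_simps)
    also have "\<dots> = (a * z + b) / (c * z + d)"
      unfolding num den using \<open>1 - q * cnj q \<noteq> 0\<close> by simp
    finally show ?thesis .
  qed
  ultimately show ?thesis
    by (subst wcomp_bdd_cong[where w' = "\<lambda>z. 1 * 1"]) auto
qed

section \<open>Linear-fractional maps and their composition operators\<close>

lemma maps_disk_strict:
  assumes le: "\<And>z. z \<in> ball 0 1 \<Longrightarrow> cmod (a * z + b) \<le> cmod (c * z + d)"
    and det: "a * d - b * c \<noteq> 0"
  shows "maps_disk a b c d"
  unfolding maps_disk_def
proof (rule ballI, rule ccontr)
  fix z0 :: complex
  assume z0: "z0 \<in> ball 0 1" and "\<not> cmod (a * z0 + b) < cmod (c * z0 + d)"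
  then have eq: "cmod (a * z0 + b) = cmod (c * z0 + d)"
    using le[OF z0] by simp
  have cd: "cmod c < cmod d"
    using le det by (rule disk_ineq_denominator)
  have nz: "c * z + d \<noteq> 0" if "z \<in> ball 0 1" for z
    using affine_nonzero[OF cd, of z] that by simp
  define F where "F z = (a * z + b) / (c * z + d)" for z
  have hol: "F holomorphic_on ball 0 1"
    unfolding F_def using nz by (intro holomorphic_intros) auto
  have "cmod (F z) \<le> cmod (F z0)" if "z \<in> ball 0 1" for z
    using le[OF that] nz[OF that] nz[OF z0] eq by (simp add: F_def norm_divide divide_simps)
  then have "F constant_on ball 0 1"
    using z0 by (intro maximum_modulus_principle[OF hol, of "ball 0 1" z0]) auto
  then have "F (1/2) = F 0"
    unfolding constant_on_def by (force simp: norm_divide)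
  then have "(a * (1/2) + b) * (c * 0 + d) = (a * 0 + b) * (c * (1/2) + d)"
    using nz[of "1/2"] nz[of 0] unfolding F_def by (subst (asm) frac_eq_eq) (simp_all add: norm_divide)
  then have "a * d - b * c = 0"
    by (simp add: algebra_simps)
  with det show False by simp
qed

lemma disk_ineq_puncture:
  assumes le: "\<And>z. z \<in> ball 0 1 \<Longrightarrow> z \<noteq> p \<Longrightarrow> cmod (a * z + b) \<le> cmod (c * z + d)"
    and z: "z \<in> ball 0 1"
  shows "cmod (a * z + b) \<le> cmod (c * z + d)"
proof -
  have "closed {z. cmod (a * z + b) \<le> cmod (c * z + d)}"
    by (intro closed_Collect_le continuous_intros)
  then have "closure (ball 0 1 - {p}) \<subseteq> {z. cmod (a * z + b) \<le> cmod (c * z + d)}"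
    using le by (intro closure_minimal) auto
  moreover have "z \<in> closure (ball 0 1 - {p})"
  proof (cases "z = p")
    case True
    have "z islimpt ball 0 1"
      using z by (intro interior_limit_point) simp
    then have "z islimpt (ball 0 1 - {p})"
      unfolding True by (simp add: islimpt_def) blast
    then show ?thesis
      by (simp add: closure_def)
  qed (use z in \<open>auto intro: subsetD[OF closure_subset]\<close>)
  ultimately show ?thesis
    by blast
qed

lemma power_bounded_le_one:
  fixes x r B :: real
  assumes "\<And>n. r * x ^ n \<le> B" "r > 0"
  shows "x \<le> 1"
proof (rule ccontr)
  assume "\<not> x \<le> 1"
  then obtain n where "B / r < x ^ n"
    using real_arch_pow[of x "B / r"] by auto
  then show False
    using assms(1)[of n] assms(2) by (simp add: divide_simps mult.commute)
qed

lemma linear_fractional_multiplier_power: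
  assumes "cmod c < cmod d"
    and "\<And>z. z \<in> ball 0 1 \<Longrightarrow> cmod (a * z + b) \<le> cmod (c * z + d)"
  shows "\<exists>v. norm v \<le> norm f \<and>
    (\<forall>z\<in>ball 0 1. hardy_fun v z = ((a * z + b) / (c * z + d)) ^ n * hardy_fun f z)"
proof (induction n)
  case (Suc n)
  then obtain u where u: "norm u \<le> norm f"
    "\<forall>z\<in>ball 0 1. hardy_fun u z = ((a * z + b) / (c * z + d)) ^ n * hardy_fun f z"
    by blast
  obtain v where "norm v \<le> norm u"
    "\<And>z. z \<in> ball 0 1 \<Longrightarrow> hardy_fun v z = (a * z + b) / (c * z + d) * hardy_fun u z"
    using linear_fractional_multiplier[OF assms, where f = u] by blast
  then show ?case
    using u by (intro exI[of _ v]) auto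
qed auto

lemma affine_power_hardy:
  obtains m where "\<And>z. z \<in> ball 0 1 \<Longrightarrow> hardy_fun m z = (p * z + q) ^ n"
proof -
  have "\<exists>m. \<forall>z\<in>ball 0 1. hardy_fun m z = (p * z + q) ^ n"
  proof (induction n)
    case 0
    show ?case
      by (intro exI[of _ "szego 0"]) (simp add: hardy_fun_szego)
  next
    case (Suc n)
    then obtain m where "\<forall>z\<in>ball 0 1. hardy_fun m z = (p * z + q) ^ n" by blast
    then show ?case
      by (intro exI[of _ "p *\<^sub>C shift m + q *\<^sub>C m"])
        (simp add: hardy_fun_simps hardy_fun_shift algebra_simps)
  qed
  then show thesis using that by blast
qed

locale disk_lft =
  fixes a b c d :: complex and \<phi> :: "complex \<Rightarrow> complex"
  assumes maps: "maps_disk a b c d"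
    and det: "a * d - b * c \<noteq> 0"
    and \<phi>: "\<And>z. z \<in> ball 0 1 \<Longrightarrow> \<phi> z = (a * z + b) / (c * z + d)"
begin

text \<open>Cowen's auxiliary map: \<open>\<sigma>\<close> is \<open>\<phi>\<inverse>\<close> conjugated by the reflection in the unit circle.\<close>

definition \<sigma> :: "complex \<Rightarrow> complex" where
  "\<sigma> z = (cnj a * z - cnj c) / (cnj d - cnj b * z)"

lemma cd: "cmod c < cmod d"
  using maps det by (rule maps_disk_denominator)

lemma bd: "cmod b < cmod d"
  using bspec[OF maps[unfolded maps_disk_def], of 0] by simp

lemma den: "z \<in> ball 0 1 \<Longrightarrow> c * z + d \<noteq> 0"
  using affine_nonzero[OF cd, of z] by simp

lemma dual_den: "z \<in> ball 0 1 \<Longrightarrow> cnj d - cnj b * z \<noteq> 0"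
  using affine_nonzero[of "- cnj b" "cnj d" z] bd by simp

lemma det_cnj: "cnj a * cnj d - cnj b * cnj c \<noteq> 0"
  using det by (metis complex_cnj_diff complex_cnj_mult complex_cnj_zero_iff)

lemma \<phi>_in: "z \<in> ball 0 1 \<Longrightarrow> \<phi> z \<in> ball 0 1"
  using bspec[OF maps[unfolded maps_disk_def], of z] den[of z]
  by (simp add: \<phi> norm_divide divide_simps)

lemma maps_disk_dual: "maps_disk (cnj a) (- cnj c) (- cnj b) (cnj d)"
  unfolding maps_disk_def
proof (rule ballI, rule ccontr)
  fix z :: complex
  assume z: "z \<in> ball 0 1" and n: "\<not> cmod (cnj a * z + - cnj c) < cmod (- cnj b * z + cnj d)"
  define N D where "N = cnj a * z - cnj c" and "D = cnj d - cnj b * z"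
  have D: "D \<noteq> 0"
    using dual_den[OF z] by (simp add: D_def)
  have le: "cmod D \<le> cmod N"
    using n by (simp add: N_def D_def)
  then have N: "N \<noteq> 0"
    using D by auto
  define w where "w = cnj (D / N)"
  have w: "cmod w \<le> 1"
    using le N by (simp add: w_def norm_divide)
  have "cnj (cnj w * N) = cnj D"
    using N by (simp add: w_def)
  then have eq: "c * w + d = cnj z * (a * w + b)"
    by (simp add: N_def D_def algebra_simps)
  have "cmod (a * w + b) \<le> cmod (c * w + d)"
    by (rule disk_ineq_closure[OF _ w]) (use maps in \<open>simp add: maps_disk_def less_imp_le\<close>)
  then have "cmod (a * w + b) \<le> cmod z * cmod (a * w + b)"
    by (simp add: eq norm_mult)
  then have "cmod (a * w + b) = 0"
    using z by (metis linorder_not_le mem_ball_0 mult.commute mult_less_cancel_left2 norm_ge_zero order_le_less)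
  then show False
    using eq affine_nonzero[OF cd w] by simp
qed

lemma dual: "disk_lft (cnj a) (- cnj c) (- cnj b) (cnj d) \<sigma>"
  by unfold_locales (use maps_disk_dual det_cnj in \<open>auto simp: \<sigma>_def mult.commute\<close>)

lemma \<sigma>_in: "z \<in> ball 0 1 \<Longrightarrow> \<sigma> z \<in> ball 0 1"
  by (rule disk_lft.\<phi>_in[OF dual])

lemma comp_op_bdd: "wcomp_bdd (\<lambda>z. 1) \<phi>"
  using maps_disk_bdd[OF maps det] wcomp_bdd_cong[of "\<lambda>z. 1" "\<lambda>z. 1" \<phi> "\<lambda>z. (a * z + b) / (c * z + d)"]
  by (simp add: \<phi>)

lemmas bounded_comp_op = comp_op_wcomp(1)[OF comp_op_bdd]
lemmas hardy_fun_comp_op = comp_op_wcomp(2)[OF comp_op_bdd]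

lemma comp_op_szego:
  assumes w: "w \<in> ball 0 1"
  shows "comp_op \<phi> (szego w) =
    cnj (1 / (cnj d - cnj b * w)) *\<^sub>C (c *\<^sub>C shift (szego (\<sigma> w)) + d *\<^sub>C szego (\<sigma> w))"
proof (rule hardy_fun_eqI)
  fix z :: complex assume z: "z \<in> ball 0 1"
  define D where "D = d - b * cnj w"
  have D: "D \<noteq> 0"
    using dual_den[OF w] unfolding D_def
    by (metis complex_cnj_cnj complex_cnj_diff complex_cnj_mult complex_cnj_zero_iff)
  have s: "cnj (\<sigma> w) = (a * cnj w - c) / D"
    by (simp add: \<sigma>_def D_def)
  have nz1: "1 - cnj w * \<phi> z \<noteq> 0" and nz2: "1 - cnj (\<sigma> w) * z \<noteq> 0"
    using affine_nonzero[of "- cnj w" 1 "\<phi> z"] w \<phi>_in[OF z]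
      affine_nonzero[of "- cnj (\<sigma> w)" 1 z] \<sigma>_in[OF w] z by simp_all
  have key: "(c * z + d) * (1 - cnj w * \<phi> z) = D * (1 - cnj (\<sigma> w) * z)"
    using den[OF z] D by (simp add: \<phi>[OF z] s field_simps) (simp add: D_def algebra_simps)
  have "hardy_fun (comp_op \<phi> (szego w)) z = 1 / (1 - cnj w * \<phi> z)"
    unfolding hardy_fun_comp_op[OF z] by (rule hardy_fun_szego[OF w \<phi>_in[OF z]])
  also have "\<dots> = (1 / D) * ((c * z + d) * (1 / (1 - cnj (\<sigma> w) * z)))"
    using key nz1 nz2 D by (simp add: divide_simps mult_ac)
  also have "\<dots> = hardy_fun (cnj (1 / (cnj d - cnj b * w)) *\<^sub>C
      (c *\<^sub>C shift (szego (\<sigma> w)) + d *\<^sub>C szego (\<sigma> w))) z"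
  proof -
    have "1 / D = cnj (1 / (cnj d - cnj b * w))"
      by (simp add: D_def)
    moreover have "(1 / D) * ((c * z + d) * k) = (1 / D) * (c * (z * k) + d * k)" for k
      by (simp add: algebra_simps)
    ultimately show ?thesis
      by (simp only: hardy_fun_simps hardy_fun_shift hardy_fun_szego[OF \<sigma>_in[OF w] z])
  qed
  finally show "hardy_fun (comp_op \<phi> (szego w)) z = \<dots>" .
qed

lemma hardy_fun_adjoint:
  assumes w: "w \<in> ball 0 1"
  shows "hardy_fun (cadjoint (comp_op \<phi>) f) w =
    1 / (cnj d - cnj b * w) * cinner f (c *\<^sub>C shift (szego (\<sigma> w)) + d *\<^sub>C szego (\<sigma> w))"
  unfolding hardy_fun_eq_cinner[OF w] cinner_cadjoint_left[OF bounded_comp_op]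
    comp_op_szego[OF w] cinner_scaleC_right by simp

lemma \<sigma>_numerator:
  assumes w: "w \<in> ball 0 1"
  shows "cnj c + cnj d * \<sigma> w = (cnj a * cnj d - cnj b * cnj c) * w / (cnj d - cnj b * w)"
    and "cnj b * \<sigma> w + cnj a = (cnj a * cnj d - cnj b * cnj c) / (cnj d - cnj b * w)"
  using dual_den[OF w] by (simp_all add: \<sigma>_def field_simps)

lemma hardy_fun_adjoint_shift:
  assumes w: "w \<in> ball 0 1"
  shows "hardy_fun (cadjoint (comp_op \<phi>) (shift m)) w =
    (cnj a * cnj d - cnj b * cnj c) * w / (cnj d - cnj b * w)\<^sup>2 * hardy_fun m (\<sigma> w)"
proof -
  have "cinner (shift m) (c *\<^sub>C shift (szego (\<sigma> w)) + d *\<^sub>C szego (\<sigma> w))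
      = (cnj c + cnj d * \<sigma> w) * hardy_fun m (\<sigma> w)"
    using \<sigma>_in[OF w]
    by (simp add: cinner_add_right cinner_scaleC_right cinner_shift hardy_fun_eq_cinner[symmetric]
        hardy_fun_shift distrib_right)
  then show ?thesis
    unfolding hardy_fun_adjoint[OF w] \<sigma>_numerator(1)[OF w] by (simp add: power2_eq_square)
qed

text \<open>The image of \<open>\<sigma>\<close> is a disk; the assumption places \<open>u\<close> in its closure, and the conclusion says
  that \<open>\<sigma>\<inverse> u\<close> lies in the closed unit disk.\<close>

lemma image_disk_le:
  assumes "cmod ((d * cnj d - b * cnj b) * u + (d * cnj c - b * cnj a)) \<le> cmod (a * d - b * c)"
  shows "cmod (cnj d * u + cnj c) \<le> cmod (cnj b * u + cnj a)"
proof -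
  define N where "N = (cmod d)\<^sup>2 - (cmod b)\<^sup>2"
  have N: "N > 0"
    using bd by (simp add: N_def power_strict_mono)
  have "(cmod ((d * cnj d - b * cnj b) * u + (d * cnj c - b * cnj a)))\<^sup>2 \<le> (cmod (a * d - b * c))\<^sup>2"
    using assms by (intro power_mono) auto
  moreover have "(cmod (a * d - b * c))\<^sup>2
      - (cmod ((d * cnj d - b * cnj b) * u + (d * cnj c - b * cnj a)))\<^sup>2
      = N * ((cmod (cnj b * u + cnj a))\<^sup>2 - (cmod (cnj d * u + cnj c))\<^sup>2)"
    unfolding N_def cmod_power2 by (simp add: power2_eq_square algebra_simps)
  ultimately have "0 \<le> N * ((cmod (cnj b * u + cnj a))\<^sup>2 - (cmod (cnj d * u + cnj c))\<^sup>2)"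
    by linarith
  then have "(cmod (cnj d * u + cnj c))\<^sup>2 \<le> (cmod (cnj b * u + cnj a))\<^sup>2"
    using N by (simp add: zero_le_mult_iff)
  then show ?thesis
    by (rule power2_le_imp_le) simp
qed

lemma maps_disk_of_image_le:
  assumes le: "\<And>z. z \<in> ball 0 1 \<Longrightarrow> z \<noteq> p \<Longrightarrow> cmod (cnj d * \<phi> z + cnj c) \<le> cmod (cnj b * \<phi> z + cnj a)"
  shows "maps_disk (cnj d * a + cnj c * c) (cnj d * b + cnj c * d) (cnj b * a + cnj a * c) (cnj b * b + cnj a * d)"
proof (rule maps_disk_strict)
  have "cmod ((cnj d * a + cnj c * c) * z + (cnj d * b + cnj c * d))
      \<le> cmod ((cnj b * a + cnj a * c) * z + (cnj b * b + cnj a * d))"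
    if z: "z \<in> ball 0 1" "z \<noteq> p" for z
  proof -
    have "cmod (c * z + d) * cmod (cnj d * \<phi> z + cnj c) \<le> cmod (c * z + d) * cmod (cnj b * \<phi> z + cnj a)"
      by (intro mult_left_mono le z) auto
    moreover have "(c * z + d) * (cnj d * \<phi> z + cnj c) = (cnj d * a + cnj c * c) * z + (cnj d * b + cnj c * d)"
      and "(c * z + d) * (cnj b * \<phi> z + cnj a) = (cnj b * a + cnj a * c) * z + (cnj b * b + cnj a * d)"
      using den[OF z(1)] by (simp_all add: \<phi>[OF z(1)] field_simps)
    ultimately show ?thesis
      by (metis norm_mult)
  qed
  then show "cmod ((cnj d * a + cnj c * c) * z + (cnj d * b + cnj c * d))
      \<le> cmod ((cnj b * a + cnj a * c) * z + (cnj b * b + cnj a * d))" if "z \<in> ball 0 1" for z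
    using that disk_ineq_puncture by blast
  have "(cnj d * a + cnj c * c) * (cnj b * b + cnj a * d) - (cnj d * b + cnj c * d) * (cnj b * a + cnj a * c)
      = (a * d - b * c) * (cnj a * cnj d - cnj b * cnj c)"
    by (simp add: algebra_simps)
  then show "(cnj d * a + cnj c * c) * (cnj b * b + cnj a * d) - (cnj d * b + cnj c * d) * (cnj b * a + cnj a * c) \<noteq> 0"
    using det det_cnj by simp
qed

lemma image_subset_maps_disk:
  assumes sub: "\<phi> ` ball 0 1 \<subseteq> \<sigma> ` ball 0 1"
  shows "maps_disk (cnj d * a + cnj c * c) (cnj d * b + cnj c * d) (cnj b * a + cnj a * c) (cnj b * b + cnj a * d)"
proof (rule maps_disk_of_image_le)
  fix z :: complex assume "z \<in> ball 0 1"
  then obtain y where y: "y \<in> ball 0 1" "\<phi> z = \<sigma> y"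
    using sub by blast
  have "cmod (cnj d * \<sigma> y + cnj c) \<le> cmod (cnj b * \<sigma> y + cnj a)"
    using y(1) unfolding add.commute[of "cnj d * _"] \<sigma>_numerator[OF y(1)]
    by (simp add: norm_divide norm_mult divide_right_mono mult_left_le)
  then show "cmod (cnj d * \<phi> z + cnj c) \<le> cmod (cnj b * \<phi> z + cnj a)"
    by (simp add: y(2))
qed

lemma maps_disk_image_subset:
  assumes X: "maps_disk (cnj d * a + cnj c * c) (cnj d * b + cnj c * d) (cnj b * a + cnj a * c) (cnj b * b + cnj a * d)"
  shows "\<phi> ` ball 0 1 \<subseteq> \<sigma> ` ball 0 1"
proof
  fix u assume "u \<in> \<phi> ` ball 0 1"
  then obtain z where z: "z \<in> ball 0 1" and u: "u = \<phi> z" by blast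
  have P: "(c * z + d) * (cnj d * u + cnj c) = (cnj d * a + cnj c * c) * z + (cnj d * b + cnj c * d)"
    and Q: "(c * z + d) * (cnj b * u + cnj a) = (cnj b * a + cnj a * c) * z + (cnj b * b + cnj a * d)"
    using den[OF z] by (simp_all add: u \<phi>[OF z] field_simps)
  have "cmod ((c * z + d) * (cnj d * u + cnj c)) < cmod ((c * z + d) * (cnj b * u + cnj a))"
    unfolding P Q using X z by (simp add: maps_disk_def)
  then have lt: "cmod (cnj d * u + cnj c) < cmod (cnj b * u + cnj a)"
    using den[OF z] by (simp add: norm_mult)
  define y where "y = (cnj d * u + cnj c) / (cnj b * u + cnj a)"
  have nz: "cnj b * u + cnj a \<noteq> 0"
    using lt by auto
  have y: "y \<in> ball 0 1"
    using lt nz by (simp add: y_def norm_divide divide_simps)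
  have "y * (cnj b * u + cnj a) = cnj d * u + cnj c"
    using nz by (simp add: y_def)
  then have "u * (cnj d - cnj b * y) = cnj a * y - cnj c"
    by (simp add: algebra_simps)
  then have "u = \<sigma> y"
    using dual_den[OF y] by (simp add: \<sigma>_def eq_divide_eq)
  then show "u \<in> \<sigma> ` ball 0 1"
    using y by blast
qed

lemma dual_\<sigma>: "z \<in> ball 0 1 \<Longrightarrow> disk_lft.\<sigma> (cnj a) (- cnj c) (- cnj b) (cnj d) z = \<phi> z"
  by (simp add: disk_lft.\<sigma>_def[OF dual] \<phi> add.commute)

text \<open>The test functions \<open>z (p z + q) ^ n\<close> are chosen such that \<open>p \<sigma> + q\<close> is a Blaschke factor, which
  keeps their images under the adjoint bounded; at \<open>\<phi> w\<close> they stay bounded only if \<open>\<phi> w\<close> lies in the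
  closure of the image of \<open>\<sigma>\<close>.\<close>

lemma coposinormal_imp_image_subset:
  assumes "coposinormal (comp_op \<phi>)"
  shows "\<phi> ` ball 0 1 \<subseteq> \<sigma> ` ball 0 1"
proof (rule maps_disk_image_subset, rule maps_disk_of_image_le[of "- b / a"], rule image_disk_le)
  let ?A = "comp_op \<phi>" and ?\<Delta> = "a * d - b * c"
  obtain K where K: "\<And>f. norm (?A f) \<le> K * norm (cadjoint ?A f)"
    using assms posinormal_norm_le[of "cadjoint ?A"]
    unfolding coposinormal_def cadjoint_cadjoint[OF bounded_comp_op] by blast
  have lt: "cmod (- cnj b) < cmod (cnj d)"
    using bd by simp
  obtain R where R: "\<And>f z. z \<in> ball 0 1 \<Longrightarrow> hardy_fun (R f) z = 1 / (- cnj b * z + cnj d) * hardy_fun f z"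
    by (rule wcomp_bdd_op[OF wcomp_bdd_inverse_affine[OF lt]]) blast
  define v0 where "v0 = cnj ?\<Delta> *\<^sub>C shift (R (R (szego 0)))"
  have v0: "hardy_fun v0 z = cnj ?\<Delta> * z / (cnj d - cnj b * z)\<^sup>2" if "z \<in> ball 0 1" for z
    using that by (simp add: v0_def hardy_fun_simps hardy_fun_shift R hardy_fun_szego power2_eq_square)
  have bl: "cmod (d * z + - b) \<le> cmod (- cnj b * z + cnj d)" if "z \<in> ball 0 1" for z
  proof (rule power2_le_imp_le)
    have "(cmod (- cnj b * z + cnj d))\<^sup>2 - (cmod (d * z + - b))\<^sup>2 = ((cmod d)\<^sup>2 - (cmod b)\<^sup>2) * (1 - (cmod z)\<^sup>2)"
      unfolding cmod_power2 by (simp add: power2_eq_square algebra_simps)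
    also have "\<dots> \<ge> 0"
      using that bd by (intro mult_nonneg_nonneg) (auto simp: abs_square_le_1 power_mono)
    finally show "(cmod (d * z + - b))\<^sup>2 \<le> (cmod (- cnj b * z + cnj d))\<^sup>2" by simp
  qed simp
  fix w :: complex
  assume w: "w \<in> ball 0 1" and wp: "w \<noteq> - b / a"
  define p q where "p = (d * cnj d - b * cnj b) / cnj ?\<Delta>" and "q = (d * cnj c - b * cnj a) / cnj ?\<Delta>"
  have nz: "cnj ?\<Delta> \<noteq> 0"
    using det by (simp only: complex_cnj_zero_iff) simp
  have pq: "p * \<sigma> z + q = (d * z + - b) / (- cnj b * z + cnj d)" if "z \<in> ball 0 1" for z
  proof -
    have "((d * cnj d - b * cnj b) * \<sigma> z + (d * cnj c - b * cnj a)) * (cnj d - cnj b * z) = cnj ?\<Delta> * (d * z - b)"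
    proof -
      have *: "\<sigma> z * (cnj d - cnj b * z) = cnj a * z - cnj c"
        using dual_den[OF that] by (simp add: \<sigma>_def)
      have "(N * y + e) * D = N * t + e * D" if "y * D = t" for N y e D t :: complex
        using that by (simp add: algebra_simps)
      from this[OF *] have "((d * cnj d - b * cnj b) * \<sigma> z + (d * cnj c - b * cnj a)) * (cnj d - cnj b * z)
          = (d * cnj d - b * cnj b) * (cnj a * z - cnj c) + (d * cnj c - b * cnj a) * (cnj d - cnj b * z)"
        .
      then show ?thesis
        by (simp only:) (simp add: algebra_simps)
    qed
    then have "(d * cnj d - b * cnj b) * \<sigma> z + (d * cnj c - b * cnj a) = cnj ?\<Delta> * (d * z - b) / (cnj d - cnj b * z)"
      using dual_den[OF that] by (subst eq_divide_eq) simp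
    moreover have "p * \<sigma> z + q = ((d * cnj d - b * cnj b) * \<sigma> z + (d * cnj c - b * cnj a)) / cnj ?\<Delta>"
      by (simp add: p_def q_def add_divide_distrib)
    ultimately show ?thesis
      using nz by simp
  qed
  have bound: "cmod (\<phi> w) * cmod (p * \<phi> w + q) ^ n \<le> \<bar>K\<bar> * norm v0 * norm (szego w)" for n
  proof -
    obtain m where m: "\<And>z. z \<in> ball 0 1 \<Longrightarrow> hardy_fun m z = (p * z + q) ^ n"
      using affine_power_hardy by blast
    obtain v where v: "norm v \<le> norm v0"
      "\<forall>z\<in>ball 0 1. hardy_fun v z = ((d * z + - b) / (- cnj b * z + cnj d)) ^ n * hardy_fun v0 z"
      using linear_fractional_multiplier_power[OF lt bl] by blast
    have "cadjoint ?A (shift m) = v"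
    proof (rule hardy_fun_eqI)
      fix z :: complex assume z: "z \<in> ball 0 1"
      show "hardy_fun (cadjoint ?A (shift m)) z = hardy_fun v z"
        unfolding hardy_fun_adjoint_shift[OF z] m[OF \<sigma>_in[OF z]] pq[OF z] bspec[OF v(2) z] v0[OF z]
        by (simp add: mult_ac)
    qed
    then have "norm (?A (shift m)) \<le> \<bar>K\<bar> * norm v0"
      using K[of "shift m"] v(1) by (smt (verit) mult_mono norm_ge_zero mult_right_mono)
    moreover have "hardy_fun (?A (shift m)) w = \<phi> w * (p * \<phi> w + q) ^ n"
      by (simp add: hardy_fun_comp_op[OF w] hardy_fun_shift m[OF \<phi>_in[OF w]])
    ultimately show ?thesis
      using hardy_fun_le_norm[OF w, of "?A (shift m)"]
      by (smt (verit) mult_right_mono norm_ge_zero norm_mult norm_power)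
  qed
  have "a * w + b \<noteq> 0"
  proof
    assume *: "a * w + b = 0"
    then have "a \<noteq> 0"
      using det by auto
    with * have "w = - b / a"
      by (metis add_eq_0_iff2 mult.commute nonzero_eq_divide_eq)
    with wp show False by simp
  qed
  then have "\<phi> w \<noteq> 0"
    using den[OF w] by (simp add: \<phi>[OF w])
  then have "cmod (p * \<phi> w + q) \<le> 1"
    using power_bounded_le_one[OF bound] by simp
  moreover have "p * \<phi> w + q = ((d * cnj d - b * cnj b) * \<phi> w + (d * cnj c - b * cnj a)) / cnj ?\<Delta>"
    by (simp add: p_def q_def add_divide_distrib)
  ultimately show "cmod ((d * cnj d - b * cnj b) * \<phi> w + (d * cnj c - b * cnj a)) \<le> cmod ?\<Delta>"
    using det by (simp only: norm_divide complex_mod_cnj) (simp add: divide_le_eq_1)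
qed

text \<open>The coefficients \<open>p, q, r, s\<close> are those of \<open>\<sigma> \<circ> \<phi>\<inverse>\<close>, which maps the disk into itself because it
  is Cowen's auxiliary map of \<open>\<sigma>\<inverse> \<circ> \<phi>\<close>.\<close>

lemma image_subset_imp_coposinormal:
  assumes sub: "\<phi> ` ball 0 1 \<subseteq> \<sigma> ` ball 0 1"
  shows "coposinormal (comp_op \<phi>)"
proof -
  define p q r s where "p = d * cnj a + c * cnj c" and "q = - (b * cnj a + a * cnj c)"
    and "r = - (d * cnj b + c * cnj d)" and "s = b * cnj b + a * cnj d"
  interpret X: disk_lft "cnj d * a + cnj c * c" "cnj d * b + cnj c * d" "cnj b * a + cnj a * c"
    "cnj b * b + cnj a * d" "\<lambda>z. ((cnj d * a + cnj c * c) * z + (cnj d * b + cnj c * d)) /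
      ((cnj b * a + cnj a * c) * z + (cnj b * b + cnj a * d))"
  proof
    have "(cnj d * a + cnj c * c) * (cnj b * b + cnj a * d) - (cnj d * b + cnj c * d) * (cnj b * a + cnj a * c)
        = (a * d - b * c) * (cnj a * cnj d - cnj b * cnj c)"
      by (simp add: algebra_simps)
    then show "(cnj d * a + cnj c * c) * (cnj b * b + cnj a * d) - (cnj d * b + cnj c * d) * (cnj b * a + cnj a * c) \<noteq> 0"
      using det det_cnj by simp
  qed (use image_subset_maps_disk[OF sub] in auto)
  interpret \<theta>: disk_lft p q r s "\<lambda>z. (p * z + q) / (r * z + s)"
  proof
    show "maps_disk p q r s"
      using X.maps_disk_dual by (simp add: p_def q_def r_def s_def mult_ac add_ac)
    have "p * s - q * r = (a * d - b * c) * (cnj a * cnj d - cnj b * cnj c)"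
      by (simp add: p_def q_def r_def s_def algebra_simps)
    then show "p * s - q * r \<noteq> 0"
      using det det_cnj by simp
  qed auto
  obtain M where M: "bounded_clinear M"
    "\<And>f z. z \<in> ball 0 1 \<Longrightarrow> hardy_fun (M f) z = (c * z + d) * hardy_fun f z"
    by (rule wcomp_bdd_op[OF wcomp_bdd_affine[of c d]]) blast
  have "wcomp_bdd (\<lambda>z. (- c * z + a) * (1 / (r * z + s) * 1)) (\<lambda>z. (p * z + q) / (r * z + s))"
    by (intro wcomp_bdd_weight wcomp_bdd_affine wcomp_bdd_inverse_affine \<theta>.cd \<theta>.comp_op_bdd)
  then obtain U where U: "bounded_clinear U" "\<And>f z. z \<in> ball 0 1 \<Longrightarrow>
      hardy_fun (U f) z = (- c * z + a) * (1 / (r * z + s) * 1) * hardy_fun f ((p * z + q) / (r * z + s))"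
    by (rule wcomp_bdd_op) blast
  define Y where "Y f = U (cadjoint M f)" for f
  have Y: "bounded_clinear Y"
    unfolding Y_def by (rule bounded_clinear_compose[OF U(1) bounded_clinear_cadjoint[OF M(1)]])
  have "cadjoint (comp_op \<phi>) f = comp_op \<phi> (Y f)" for f
  proof (rule hardy_fun_eqI)
    fix w :: complex assume w: "w \<in> ball 0 1"
    let ?u = "\<phi> w" and ?\<Delta> = "a * d - b * c"
    have 1: "(c * w + d) * (- c * ?u + a) = ?\<Delta>"
      using den[OF w] by (simp add: \<phi>[OF w] field_simps)
    have 2: "(c * w + d) * (r * ?u + s) = ?\<Delta> * (cnj d - cnj b * w)"
      using den[OF w] by (simp add: \<phi>[OF w] r_def s_def field_simps)
    have 3: "(c * w + d) * (p * ?u + q) = ?\<Delta> * (cnj a * w - cnj c)"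
      using den[OF w] by (simp add: \<phi>[OF w] p_def q_def field_simps)
    have weight: "(- c * ?u + a) * (1 / (r * ?u + s) * 1) = 1 / (cnj d - cnj b * w)"
    proof -
      have "(- c * ?u + a) * (1 / (r * ?u + s) * 1) = ((c * w + d) * (- c * ?u + a)) / ((c * w + d) * (r * ?u + s))"
        using den[OF w] by simp
      then show ?thesis
        unfolding 1 2 using det by simp
    qed
    have map: "(p * ?u + q) / (r * ?u + s) = \<sigma> w"
    proof -
      have "(p * ?u + q) / (r * ?u + s) = ((c * w + d) * (p * ?u + q)) / ((c * w + d) * (r * ?u + s))"
        using den[OF w] by simp
      then show ?thesis
        unfolding 2 3 \<sigma>_def using det by simp
    qed
    have Mk: "M (szego (\<sigma> w)) = c *\<^sub>C shift (szego (\<sigma> w)) + d *\<^sub>C szego (\<sigma> w)"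
      by (rule hardy_fun_eqI) (simp add: M(2) hardy_fun_simps hardy_fun_shift distrib_right)
    have "hardy_fun (comp_op \<phi> (Y f)) w = 1 / (cnj d - cnj b * w) * hardy_fun (cadjoint M f) (\<sigma> w)"
      unfolding hardy_fun_comp_op[OF w] Y_def U(2)[OF \<phi>_in[OF w]] weight map ..
    also have "hardy_fun (cadjoint M f) (\<sigma> w) = cinner f (M (szego (\<sigma> w)))"
      unfolding hardy_fun_eq_cinner[OF \<sigma>_in[OF w]] by (rule cinner_cadjoint_left[OF M(1)])
    finally show "hardy_fun (cadjoint (comp_op \<phi>) f) w = hardy_fun (comp_op \<phi> (Y f)) w"
      unfolding hardy_fun_adjoint[OF w] Mk by simp
  qed
  then have "posinormal (cadjoint (comp_op \<phi>))"
    by (intro posinormalI[OF bounded_clinear_cadjoint[OF bounded_comp_op] Y])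
      (simp add: cadjoint_cadjoint[OF bounded_comp_op])
  then show ?thesis
    using bounded_comp_op by (simp add: coposinormal_def)
qed

lemma posinormal_imp_image_subset:
  assumes "posinormal (comp_op \<phi>)"
  shows "\<sigma> ` ball 0 1 \<subseteq> \<phi> ` ball 0 1"
proof -
  let ?A = "comp_op \<phi>" and ?\<Delta> = "a * d - b * c"
  interpret D: disk_lft "cnj a" "- cnj c" "- cnj b" "cnj d" \<sigma>
    by (rule dual)
  obtain K where K: "\<And>f. norm (cadjoint ?A f) \<le> K * norm (?A f)"
    using posinormal_norm_le[OF assms] by blast
  define v0 where "v0 = ?A (shift (szego 0))"
  have v0: "hardy_fun v0 z = \<phi> z" if "z \<in> ball 0 1" for z
    using \<phi>_in[OF that] by (simp add: v0_def hardy_fun_comp_op[OF that] hardy_fun_shift hardy_fun_szego)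
  have bl: "cmod (cnj d * z + cnj c) \<le> cmod (c * z + d)" if "z \<in> ball 0 1" for z
  proof (rule power2_le_imp_le)
    have "(cmod (c * z + d))\<^sup>2 - (cmod (cnj d * z + cnj c))\<^sup>2 = ((cmod d)\<^sup>2 - (cmod c)\<^sup>2) * (1 - (cmod z)\<^sup>2)"
      unfolding cmod_power2 by (simp add: power2_eq_square algebra_simps)
    also have "\<dots> \<ge> 0"
      using that cd by (intro mult_nonneg_nonneg) (auto simp: abs_square_le_1 power_mono)
    finally show "(cmod (cnj d * z + cnj c))\<^sup>2 \<le> (cmod (c * z + d))\<^sup>2" by simp
  qed simp
  define p q where "p = (d * cnj d - c * cnj c) / ?\<Delta>" and "q = (a * cnj c - b * cnj d) / ?\<Delta>"
  have pq: "p * \<phi> z + q = (cnj d * z + cnj c) / (c * z + d)" if "z \<in> ball 0 1" for z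
  proof -
    have "((d * cnj d - c * cnj c) * \<phi> z + (a * cnj c - b * cnj d)) * (c * z + d) = ?\<Delta> * (cnj d * z + cnj c)"
      using den[OF that] by (simp add: \<phi>[OF that] field_simps)
    then have "(d * cnj d - c * cnj c) * \<phi> z + (a * cnj c - b * cnj d) = ?\<Delta> * (cnj d * z + cnj c) / (c * z + d)"
      using den[OF that] by (subst eq_divide_eq) simp
    moreover have "p * \<phi> z + q = ((d * cnj d - c * cnj c) * \<phi> z + (a * cnj c - b * cnj d)) / ?\<Delta>"
      by (simp add: p_def q_def add_divide_distrib)
    ultimately show ?thesis
      using det by simp
  qed
  have le: "cmod (p * \<sigma> w + q) \<le> 1" if w: "w \<in> ball 0 1" "w \<noteq> 0" for w
  proof (rule power_bounded_le_one)
    let ?r = "cmod ((cnj a * cnj d - cnj b * cnj c) * w / (cnj d - cnj b * w)\<^sup>2)"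
    show "?r > 0"
      using det_cnj w dual_den[OF w(1)] by simp
    fix n
    obtain m where m: "\<And>z. z \<in> ball 0 1 \<Longrightarrow> hardy_fun m z = (p * z + q) ^ n"
      using affine_power_hardy by blast
    obtain v where v: "norm v \<le> norm v0"
      "\<forall>z\<in>ball 0 1. hardy_fun v z = ((cnj d * z + cnj c) / (c * z + d)) ^ n * hardy_fun v0 z"
      using linear_fractional_multiplier_power[OF cd bl] by blast
    have "?A (shift m) = v"
    proof (rule hardy_fun_eqI)
      fix z :: complex assume z: "z \<in> ball 0 1"
      show "hardy_fun (?A (shift m)) z = hardy_fun v z"
        unfolding hardy_fun_comp_op[OF z] hardy_fun_shift m[OF \<phi>_in[OF z]] pq[OF z] bspec[OF v(2) z] v0[OF z]
        by (simp add: mult_ac)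
    qed
    then have "norm (cadjoint ?A (shift m)) \<le> \<bar>K\<bar> * norm v0"
      using K[of "shift m"] v(1) by (smt (verit) mult_mono norm_ge_zero mult_right_mono)
    moreover have "cmod (hardy_fun (cadjoint ?A (shift m)) w) = ?r * cmod (p * \<sigma> w + q) ^ n"
      unfolding hardy_fun_adjoint_shift[OF w(1)] m[OF \<sigma>_in[OF w(1)]]
      by (simp only: norm_mult norm_power norm_divide)
    ultimately show "?r * cmod (p * \<sigma> w + q) ^ n \<le> \<bar>K\<bar> * norm v0 * norm (szego w)"
      using hardy_fun_le_norm[OF w(1), of "cadjoint ?A (shift m)"]
      by (smt (verit) mult_right_mono norm_ge_zero)
  qed
  have "\<sigma> ` ball 0 1 \<subseteq> D.\<sigma> ` ball 0 1"
  proof (rule D.maps_disk_image_subset, rule D.maps_disk_of_image_le[of 0], rule D.image_disk_le)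
    fix w :: complex assume w: "w \<in> ball 0 1" "w \<noteq> 0"
    have "p * \<sigma> w + q = ((d * cnj d - c * cnj c) * \<sigma> w + (a * cnj c - b * cnj d)) / ?\<Delta>"
      by (simp add: p_def q_def add_divide_distrib)
    then have "cmod ((d * cnj d - c * cnj c) * \<sigma> w + (a * cnj c - b * cnj d)) \<le> cmod ?\<Delta>"
      using le[OF w] det by (simp add: norm_divide divide_le_eq_1)
    moreover have "cmod (cnj a * cnj d - - cnj c * - cnj b) = cmod ?\<Delta>"
      by (metis complex_cnj_diff complex_cnj_mult complex_mod_cnj minus_mult_minus mult.commute)
    ultimately show "cmod ((cnj d * cnj (cnj d) - - cnj c * cnj (- cnj c)) * \<sigma> w + (cnj d * cnj (- cnj b) - - cnj c * cnj (cnj a)))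
        \<le> cmod (cnj a * cnj d - - cnj c * - cnj b)"
      by (simp add: mult_ac)
  qed
  also have "D.\<sigma> ` ball 0 1 = \<phi> ` ball 0 1"
    using dual_\<sigma> by (rule image_cong[OF refl])
  finally show ?thesis .
qed

text \<open>Here \<open>p, q, r, s\<close> are the coefficients of \<open>\<phi> \<circ> \<sigma>\<inverse>\<close>; the zero of \<open>\<phi>\<close> keeps the pole of \<open>\<sigma>\<inverse>\<close>
  outside the closed disk.\<close>

lemma image_subset_imp_posinormal:
  assumes sub: "\<sigma> ` ball 0 1 \<subseteq> \<phi> ` ball 0 1" and zero: "z0 \<in> ball 0 1" "\<phi> z0 = 0"
  shows "posinormal (comp_op \<phi>)"
proof -
  interpret D: disk_lft "cnj a" "- cnj c" "- cnj b" "cnj d" \<sigma>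
    by (rule dual)
  have "\<sigma> ` ball 0 1 \<subseteq> D.\<sigma> ` ball 0 1"
    using sub dual_\<sigma> by (metis image_cong)
  note X' = D.image_subset_maps_disk[OF this]
  define p q r s where "p = a * cnj d + b * cnj b" and "q = a * cnj c + b * cnj a"
    and "r = c * cnj d + d * cnj b" and "s = c * cnj c + d * cnj a"
  have "p * s - q * r = (a * d - b * c) * (cnj a * cnj d - cnj b * cnj c)"
    by (simp add: p_def q_def r_def s_def algebra_simps)
  then have pqrs: "p * s - q * r \<noteq> 0"
    using det det_cnj by simp
  interpret X: disk_lft "cnj p" "- cnj r" "- cnj q" "cnj s"
      "\<lambda>z. (cnj p * z + - cnj r) / (- cnj q * z + cnj s)"
  proof
    show "maps_disk (cnj p) (- cnj r) (- cnj q) (cnj s)"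
      using X' by (simp add: p_def q_def r_def s_def mult_ac add_ac)
    have "cnj p * cnj s - - cnj r * - cnj q = cnj (p * s - q * r)"
      by simp
    then show "cnj p * cnj s - - cnj r * - cnj q \<noteq> 0"
      using pqrs by (metis complex_cnj_zero_iff)
  qed auto
  interpret \<eta>: disk_lft p q r s "\<lambda>z. (p * z + q) / (r * z + s)"
    by unfold_locales (use X.maps_disk_dual pqrs in auto)
  have ba: "cmod (cnj b) < cmod (cnj a)"
  proof -
    have *: "a * z0 + b = 0"
      using zero den[OF zero(1)] by (simp add: \<phi>)
    then have "cmod b = cmod a * cmod z0"
      by (metis add_eq_0_iff norm_minus_cancel norm_mult)
    moreover have "a \<noteq> 0"
      using det * by auto
    ultimately show ?thesis
      using zero(1) by simp
  qed
  let ?\<Delta> = "cnj a * cnj d - cnj b * cnj c"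
  have "wcomp_bdd (\<lambda>z. (0 * z + ?\<Delta>) * (1 / (cnj b * z + cnj a) * 1)) (\<lambda>z. (p * z + q) / (r * z + s))"
    by (intro wcomp_bdd_weight wcomp_bdd_affine wcomp_bdd_inverse_affine ba \<eta>.comp_op_bdd)
  then obtain U where U: "bounded_clinear U" "\<And>f z. z \<in> ball 0 1 \<Longrightarrow>
      hardy_fun (U f) z = (0 * z + ?\<Delta>) * (1 / (cnj b * z + cnj a) * 1) * hardy_fun f ((p * z + q) / (r * z + s))"
    by (rule wcomp_bdd_op) blast
  obtain R where R: "bounded_clinear R"
    "\<And>f z. z \<in> ball 0 1 \<Longrightarrow> hardy_fun (R f) z = 1 / (c * z + d) * hardy_fun f z"
    by (rule wcomp_bdd_op[OF wcomp_bdd_inverse_affine[OF cd]]) blast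
  define Y where "Y f = cadjoint R (U f)" for f
  have "bounded_clinear Y"
    unfolding Y_def by (rule bounded_clinear_compose[OF bounded_clinear_cadjoint[OF R(1)] U(1)])
  moreover have "comp_op \<phi> f = cadjoint (comp_op \<phi>) (Y f)" for f
  proof (rule hardy_fun_eqI)
    fix w :: complex assume w: "w \<in> ball 0 1"
    let ?u = "\<sigma> w" and ?k = "szego (\<sigma> w)"
    have 1: "(cnj d - cnj b * w) * (p * ?u + q) = ?\<Delta> * (a * w + b)"
      using dual_den[OF w] by (simp add: \<sigma>_def p_def q_def field_simps)
    have 2: "(cnj d - cnj b * w) * (r * ?u + s) = ?\<Delta> * (c * w + d)"
      using dual_den[OF w] by (simp add: \<sigma>_def r_def s_def field_simps)
    have map: "(p * ?u + q) / (r * ?u + s) = \<phi> w"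
    proof -
      have "(p * ?u + q) / (r * ?u + s) = ((cnj d - cnj b * w) * (p * ?u + q)) / ((cnj d - cnj b * w) * (r * ?u + s))"
        using dual_den[OF w] by simp
      then show ?thesis
        unfolding 1 2 \<phi>[OF w] using det_cnj by simp
    qed
    have Rk: "R (c *\<^sub>C shift ?k + d *\<^sub>C ?k) = ?k"
      by (rule hardy_fun_eqI)
        (use den in \<open>simp add: R(2) hardy_fun_simps hardy_fun_shift mult.assoc[symmetric] flip: distrib_right\<close>)
    have "hardy_fun (cadjoint (comp_op \<phi>) (Y f)) w =
        1 / (cnj d - cnj b * w) * hardy_fun (U f) ?u"
      unfolding hardy_fun_adjoint[OF w] Y_def cinner_cadjoint_left[OF R(1)] Rk
        hardy_fun_eq_cinner[OF \<sigma>_in[OF w]] ..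
    also have "\<dots> = hardy_fun f (\<phi> w)"
      unfolding U(2)[OF \<sigma>_in[OF w]] map \<sigma>_numerator(2)[OF w]
      using det_cnj dual_den[OF w] by simp
    finally show "hardy_fun (comp_op \<phi> f) w = hardy_fun (cadjoint (comp_op \<phi>) (Y f)) w"
      by (simp add: hardy_fun_comp_op[OF w])
  qed
  ultimately show ?thesis
    by (intro posinormalI[OF bounded_comp_op])
qed

end

section \<open>Disk automorphisms and conjugation\<close>

lemma disk_automorphism_normal_form:
  assumes "disk_automorphism \<tau>"
  obtains s t where "cmod t < cmod s"
    and "\<And>z. z \<in> ball 0 1 \<Longrightarrow> \<tau> z = (s * z + t) / (cnj t * z + cnj s)"
proof -
  have hol: "\<tau> holomorphic_on ball 0 1" and bij: "bij_betw \<tau> (ball 0 1) (ball 0 1)"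
    using assms by (auto simp: disk_automorphism_def)
  have \<tau>_in: "cmod (\<tau> z) < 1" if "cmod z < 1" for z
    using bij_betw_apply[OF bij, of z] that by simp
  obtain g where g: "g holomorphic_on \<tau> ` ball 0 1"
    and g\<tau>: "\<And>z. z \<in> ball 0 1 \<Longrightarrow> g (\<tau> z) = z"
    using holomorphic_has_inverse[OF hol open_ball bij_betw_imp_inj_on[OF bij]] by metis
  have img: "\<tau> ` ball 0 1 = ball 0 1"
    using bij by (simp add: bij_betw_def)
  have g_in: "cmod (g z) < 1" if "cmod z < 1" for z
  proof -
    have "z \<in> \<tau> ` ball 0 1"
      using that by (simp add: img)
    then obtain y where y: "y \<in> ball 0 1" "z = \<tau> y"
      by blast
    then show ?thesis
      using g\<tau>[OF y(1)] by simp
  qed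
  define q where "q = \<tau> 0"
  have q: "cmod q < 1"
    unfolding q_def by (rule \<tau>_in) simp
  define F where "F = Moebius_function 0 q \<circ> \<tau>"
  define G where "G = g \<circ> Moebius_function 0 (- q)"
  have q': "cmod (- q) < 1" using q by simp
  have holF: "F holomorphic_on ball 0 1"
    unfolding F_def
    by (rule holomorphic_on_compose[OF hol]) (simp add: img Moebius_function_holomorphic[OF q])
  have holG: "G holomorphic_on ball 0 1"
    unfolding G_def
  proof (rule holomorphic_on_compose_gen[OF Moebius_function_holomorphic[OF q'], of g "ball 0 1"])
    show "g holomorphic_on ball 0 1" using g by (simp add: img)
    show "Moebius_function 0 (- q) ` ball 0 1 \<subseteq> ball 0 1"
      using Moebius_function_norm_lt_1[OF q'] by auto
  qed
  have F_in: "cmod (F z) < 1" if "cmod z < 1" for z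
    unfolding F_def comp_def by (rule Moebius_function_norm_lt_1[OF q \<tau>_in[OF that]])
  have G_in: "cmod (G z) < 1" if "cmod z < 1" for z
    unfolding G_def comp_def by (rule g_in[OF Moebius_function_norm_lt_1[OF q' that]])
  have F0: "F 0 = 0"
    by (simp add: F_def q_def Moebius_function_eq_zero)
  have MM: "Moebius_function 0 (- q) (F z) = \<tau> z" if "cmod z < 1" for z
    unfolding F_def comp_def by (rule Moebius_function_compose) (use q \<tau>_in[OF that] in auto)
  have GF: "G (F z) = z" if "cmod z < 1" for z
    unfolding G_def comp_def MM[OF that] using g\<tau> that by simp
  have G0: "G 0 = 0"
    using GF[of 0] F0 by simp
  have "cmod (F (1/2)) \<le> 1/2"
    using Schwarz_Lemma(1)[OF holF F0 F_in, of "1/2"] by (simp add: norm_divide)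
  moreover have "1/2 \<le> cmod (F (1/2))"
    using Schwarz_Lemma(1)[OF holG G0 G_in F_in, of "1/2"] GF[of "1/2"] by (simp add: norm_divide)
  ultimately have "\<exists>z. cmod z < 1 \<and> z \<noteq> 0 \<and> cmod (F z) = cmod z"
    by (intro exI[of _ "1/2"]) (simp add: norm_divide)
  then obtain \<alpha> where \<alpha>: "\<And>z. cmod z < 1 \<Longrightarrow> F z = \<alpha> * z" "cmod \<alpha> = 1"
    using Schwarz_Lemma(3)[OF holF F0 F_in, of 0] by auto
  define s where "s = csqrt \<alpha>"
  have ss: "s * s = \<alpha>"
    unfolding s_def by (metis power2_eq_square power2_csqrt)
  have ns: "cmod s = 1"
    using \<alpha>(2) ss by (metis norm_mult norm_ge_zero power2_eq_square real_sqrt_unique real_sqrt_one)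
  then have cs: "cnj s * s = 1"
    by (metis complex_norm_square mult.commute of_real_1 one_power2)
  show thesis
  proof (rule that[of "cnj s * q" s])
    show "cmod (cnj s * q) < cmod s"
      using q ns by (simp add: norm_mult)
    fix z :: complex assume "z \<in> ball 0 1"
    then have z: "cmod z < 1" by simp
    have s0: "cnj s \<noteq> 0"
      using cs by auto
    have "\<tau> z = (\<alpha> * z + q) / (1 + cnj q * (\<alpha> * z))"
      using MM[OF z] by (simp add: \<alpha>(1)[OF z] Moebius_function_simple)
    also have "\<dots> = (cnj s * (\<alpha> * z + q)) / (cnj s * (1 + cnj q * (\<alpha> * z)))"
      using s0 by simp
    also have "cnj s * (\<alpha> * z + q) = (cnj s * s) * (s * z) + cnj s * q"
      unfolding ss[symmetric] by (simp add: algebra_simps)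
    also have "cnj s * (1 + cnj q * (\<alpha> * z)) = (cnj s * s) * (s * cnj q * z) + cnj s"
      unfolding ss[symmetric] by (simp add: algebra_simps)
    finally show "\<tau> z = (s * z + cnj s * q) / (cnj (cnj s * q) * z + cnj s)"
      by (simp add: cs)
  qed
qed

lemma disk_automorphism_disk_lft:
  assumes st: "cmod t < cmod s"
    and \<tau>: "\<And>z. z \<in> ball 0 1 \<Longrightarrow> \<tau> z = (s * z + t) / (cnj t * z + cnj s)"
  shows "disk_lft s t (cnj t) (cnj s) \<tau>"
proof
  have pos: "0 < (cmod s)\<^sup>2 - (cmod t)\<^sup>2"
    using st by (simp add: power_strict_mono)
  show "maps_disk s t (cnj t) (cnj s)"
    unfolding maps_disk_def
  proof
    fix z :: complex assume z: "z \<in> ball 0 1"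
    have "(cmod (cnj t * z + cnj s))\<^sup>2 - (cmod (s * z + t))\<^sup>2 = ((cmod s)\<^sup>2 - (cmod t)\<^sup>2) * (1 - (cmod z)\<^sup>2)"
      unfolding cmod_power2 by (simp add: power2_eq_square algebra_simps)
    also have "\<dots> > 0"
      using z by (intro mult_pos_pos pos) (auto simp: abs_square_less_1)
    finally show "cmod (s * z + t) < cmod (cnj t * z + cnj s)"
      by (intro power2_less_imp_less[of "cmod (s * z + t)"]) auto
  qed
  have "s * cnj s - t * cnj t = complex_of_real ((cmod s)\<^sup>2 - (cmod t)\<^sup>2)"
    by (simp only: of_real_diff complex_norm_square)
  then show "s * cnj s - t * cnj t \<noteq> 0"
    using pos by (metis less_irrefl of_real_eq_0_iff)
qed (rule \<tau>)

lemma disk_lft_of_selfmap: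
  assumes "analytic_selfmap \<phi>" "linear_fractional \<phi>" "\<not> \<phi> constant_on ball 0 1"
  obtains a b c d where "disk_lft a b c d \<phi>"
proof -
  obtain a b c d where nz: "\<And>z. z \<in> ball 0 1 \<Longrightarrow> c * z + d \<noteq> 0"
    and eq: "\<And>z. z \<in> ball 0 1 \<Longrightarrow> \<phi> z = (a * z + b) / (c * z + d)"
    using assms(2) unfolding linear_fractional_def by blast
  have "maps_disk a b c d"
    unfolding maps_disk_def
  proof
    fix z :: complex assume z: "z \<in> ball 0 1"
    then have "cmod (\<phi> z) < 1"
      using assms(1) unfolding analytic_selfmap_def by (metis image_subset_iff mem_ball_0)
    then show "cmod (a * z + b) < cmod (c * z + d)"
      using nz[OF z] by (simp add: eq[OF z] norm_divide divide_simps)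
  qed
  moreover have "a * d - b * c \<noteq> 0"
  proof
    assume det: "a * d - b * c = 0"
    have d: "d \<noteq> 0" using nz[of 0] by simp
    have "\<phi> z = b / d" if z: "z \<in> ball 0 1" for z
    proof -
      have "(a * z + b) * d = b * (c * z + d)"
        using det by (simp add: algebra_simps)
      then show ?thesis
        using nz[OF z] d by (simp add: eq[OF z] frac_eq_eq)
    qed
    then have "\<phi> constant_on ball 0 1"
      unfolding constant_on_def by blast
    with assms(3) show False by simp
  qed
  ultimately have "disk_lft a b c d \<phi>"
    using eq by unfold_locales auto
  then show thesis by (rule that)
qed

lemma (in disk_lft) conjugate_disk_lft:
  assumes st: "cmod t < cmod s"
    and \<tau>: "\<And>z. z \<in> ball 0 1 \<Longrightarrow> \<tau> z = (s * z + t) / (cnj t * z + cnj s)"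
    and \<tau>': "\<And>z. z \<in> ball 0 1 \<Longrightarrow> \<tau>' z \<in> ball 0 1 \<and> \<tau> (\<tau>' z) = z"
  obtains a' b' c' d' where "disk_lft a' b' c' d' (\<tau> \<circ> \<phi> \<circ> \<tau>')"
    and "\<And>z. z \<in> ball 0 1 \<Longrightarrow> disk_lft.\<sigma> a' b' c' d' (\<tau> z) = \<tau> (\<sigma> z)"
proof -
  interpret T: disk_lft s t "cnj t" "cnj s" \<tau>
    by (rule disk_automorphism_disk_lft[OF st \<tau>])
  define \<delta> where "\<delta> = s * cnj s - t * cnj t"
  define a' b' c' d' where
    "a' = (s * a + t * c) * cnj s - (s * b + t * d) * cnj t" and
    "b' = (s * b + t * d) * s - (s * a + t * c) * t" and
    "c' = (cnj t * a + cnj s * c) * cnj s - (cnj t * b + cnj s * d) * cnj t" and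
    "d' = (cnj t * b + cnj s * d) * s - (cnj t * a + cnj s * c) * t"
  have \<delta>: "\<delta> \<noteq> 0"
    using T.det by (simp add: \<delta>_def)
  have num: "a' * (s * z + t) + b' * (cnj t * z + cnj s) = \<delta> * (s * (a * z + b) + t * (c * z + d))"
    and denom: "c' * (s * z + t) + d' * (cnj t * z + cnj s) = \<delta> * (cnj t * (a * z + b) + cnj s * (c * z + d))" for z
    by (simp_all add: a'_def b'_def c'_def d'_def \<delta>_def algebra_simps)
  have num': "cnj a' * (s * z + t) - cnj c' * (cnj t * z + cnj s)
      = \<delta> * (s * (cnj a * z - cnj c) + t * (cnj d - cnj b * z))"
    and denom': "cnj d' * (cnj t * z + cnj s) - cnj b' * (s * z + t)
      = \<delta> * (cnj t * (cnj a * z - cnj c) + cnj s * (cnj d - cnj b * z))" for z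
    by (simp_all add: a'_def b'_def c'_def d'_def \<delta>_def algebra_simps)
  have frac: "(p * \<tau> z + q) = (p * (s * z + t) + q * (cnj t * z + cnj s)) / (cnj t * z + cnj s)"
    if "z \<in> ball 0 1" for p q z
    using T.den[OF that] by (simp add: \<tau>[OF that] field_simps)
  have \<tau>_frac: "\<tau> (u / v) = (s * u + t * v) / (cnj t * u + cnj s * v)"
    if "u / v \<in> ball 0 1" "v \<noteq> 0" for u v
  proof -
    have "\<tau> (u / v) = (v * (s * (u / v) + t)) / (v * (cnj t * (u / v) + cnj s))"
      using that by (simp add: \<tau>)
    also have "v * (s * (u / v) + t) = s * u + t * v"
      using that(2) by (simp add: field_simps)
    also have "v * (cnj t * (u / v) + cnj s) = cnj t * u + cnj s * v"
      using that(2) by (simp add: field_simps)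
    finally show ?thesis .
  qed
  have \<psi>: "\<tau> (\<phi> z) = (a' * \<tau> z + b') / (c' * \<tau> z + d')" and nz: "c' * \<tau> z + d' \<noteq> 0"
    if z: "z \<in> ball 0 1" for z
  proof -
    have in': "(a * z + b) / (c * z + d) \<in> ball 0 1"
      using \<phi>_in[OF z] by (simp add: \<phi>[OF z])
    have "cnj t * \<phi> z + cnj s \<noteq> 0"
      by (rule T.den[OF \<phi>_in[OF z]])
    moreover have "cnj t * (a * z + b) + cnj s * (c * z + d) = (c * z + d) * (cnj t * \<phi> z + cnj s)"
      using den[OF z] by (simp add: \<phi>[OF z] field_simps)
    ultimately have "cnj t * (a * z + b) + cnj s * (c * z + d) \<noteq> 0"
      using den[OF z] by simp
    then show "c' * \<tau> z + d' \<noteq> 0"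
      unfolding frac[OF z] denom using \<delta> T.den[OF z] by simp
    show "\<tau> (\<phi> z) = (a' * \<tau> z + b') / (c' * \<tau> z + d')"
      unfolding frac[OF z] num denom \<phi>[OF z] \<tau>_frac[OF in' den[OF z]]
      using \<delta> T.den[OF z] by simp
  qed
  have L: "disk_lft a' b' c' d' (\<tau> \<circ> \<phi> \<circ> \<tau>')"
  proof
    show eq: "(\<tau> \<circ> \<phi> \<circ> \<tau>') z = (a' * z + b') / (c' * z + d')" if "z \<in> ball 0 1" for z
      using \<psi>[of "\<tau>' z"] \<tau>'[OF that] by simp
    show "maps_disk a' b' c' d'"
      unfolding maps_disk_def
    proof
      fix z :: complex assume z: "z \<in> ball 0 1"
      have "cmod ((a' * z + b') / (c' * z + d')) < 1"
        using T.\<phi>_in[OF \<phi>_in, of "\<tau>' z"] \<tau>'[OF z] eq[OF z] by simp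
      moreover have "c' * z + d' \<noteq> 0"
        using nz[of "\<tau>' z"] \<tau>'[OF z] by simp
      ultimately show "cmod (a' * z + b') < cmod (c' * z + d')"
        by (simp add: norm_divide divide_simps)
    qed
    have "a' * d' - b' * c' = \<delta>\<^sup>2 * (a * d - b * c)"
      by (simp add: a'_def b'_def c'_def d'_def \<delta>_def power2_eq_square algebra_simps)
    then show "a' * d' - b' * c' \<noteq> 0"
      using \<delta> det by simp
  qed
  moreover have "disk_lft.\<sigma> a' b' c' d' (\<tau> z) = \<tau> (\<sigma> z)" if z: "z \<in> ball 0 1" for z
  proof -
    have in': "(cnj a * z - cnj c) / (cnj d - cnj b * z) \<in> ball 0 1"
      using \<sigma>_in[OF z] by (simp add: \<sigma>_def)
    have n: "cnj a' * \<tau> z - cnj c' = (cnj a' * (s * z + t) - cnj c' * (cnj t * z + cnj s)) / (cnj t * z + cnj s)"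
      using frac[OF z, of "cnj a'" "- cnj c'"] by simp
    have d: "cnj d' - cnj b' * \<tau> z = (cnj d' * (cnj t * z + cnj s) - cnj b' * (s * z + t)) / (cnj t * z + cnj s)"
      using frac[OF z, of "- cnj b'" "cnj d'"] by (simp add: algebra_simps)
    show ?thesis
      unfolding disk_lft.\<sigma>_def[OF L] n d num' denom' unfolding \<sigma>_def \<tau>_frac[OF in' dual_den[OF z]]
      using \<delta> T.den[OF z] by simp
  qed
  ultimately show thesis by (rule that)
qed

section \<open>Bounded analytic functions\<close>

lemma sum_roots_unity_square:
  fixes a :: "nat \<Rightarrow> complex"
  assumes N: "N > 0"
  defines "\<omega> \<equiv> cis (2 * pi / real N)"
  shows "(\<Sum>j<N. (cmod (\<Sum>n<N. a n * (\<omega> ^ j) ^ n))\<^sup>2) = real N * (\<Sum>n<N. (cmod (a n))\<^sup>2)"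
proof -
  have orth: "(\<Sum>j<N. (\<omega> ^ j) ^ n * cnj ((\<omega> ^ j) ^ m)) = (if n = m then of_nat N else 0)"
    if nm: "n < N" "m < N" for n m
  proof -
    define x where "x = cis (2 * pi * (real n - real m) / real N)"
    have tm: "(\<omega> ^ j) ^ n * cnj ((\<omega> ^ j) ^ m) = x ^ j" for j
      by (simp add: \<omega>_def x_def Complex.DeMoivre cis_cnj cis_mult mult_ac diff_divide_distrib
          ring_distribs add_divide_distrib)
    show ?thesis
    proof (cases "n = m")
      case True
      then show ?thesis unfolding tm by (simp add: x_def)
    next
      case False
      have "x ^ N = cis (2 * pi * (real n - real m))"
        using N by (simp add: x_def Complex.DeMoivre)
      also have "\<dots> = 1"
        using cis_multiple_2pi[of "real n - real m"] by simp
      finally have xN: "x ^ N = 1" .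
      have "x \<noteq> 1"
      proof
        assume "x = 1"
        then have "cos (2 * pi * (real n - real m) / real N) = 1"
          unfolding x_def by (metis cis.sel(1) one_complex.sel(1))
        then obtain k :: int where "2 * pi * (real n - real m) / real N = of_int k * (2 * pi)"
          using cos_one_2pi_int by (metis mult.commute mult.left_commute)
        then have "(2 * pi) * (real n - real m) = (2 * pi) * (of_int k * real N)"
          using N by (simp add: divide_eq_eq mult_ac)
        then have "real n - real m = of_int k * real N"
          by simp
        then have k: "int n - int m = k * int N"
          by (metis of_int_diff of_int_eq_iff of_int_mult of_int_of_nat_eq)
        then have "int N dvd int n - int m"
          by simp
        moreover have "\<bar>int n - int m\<bar> < int N"
          using nm by auto
        ultimately have "int n - int m = 0"
          using zdvd_imp_le[of "int N" "\<bar>int n - int m\<bar>"] by force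
        with False show False by simp
      qed
      then show ?thesis
        unfolding tm using False by (simp add: sum_gp_strict xN)
    qed
  qed
  have "complex_of_real (\<Sum>j<N. (cmod (\<Sum>n<N. a n * (\<omega> ^ j) ^ n))\<^sup>2)
      = (\<Sum>j<N. \<Sum>n<N. \<Sum>m<N. (a n * cnj (a m)) * ((\<omega> ^ j) ^ n * cnj ((\<omega> ^ j) ^ m)))"
    unfolding of_real_sum complex_norm_square cnj_sum sum_product
    by (simp add: mult_ac)
  also have "\<dots> = (\<Sum>n<N. \<Sum>m<N. (a n * cnj (a m)) * (\<Sum>j<N. (\<omega> ^ j) ^ n * cnj ((\<omega> ^ j) ^ m)))"
    unfolding sum_distrib_left
    by (subst sum.swap, rule sum.cong[OF refl], rule sum.swap)
  also have "\<dots> = (\<Sum>n<N. \<Sum>m<N. (a n * cnj (a m)) * (if n = m then of_nat N else 0))"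
    by (intro sum.cong refl) (simp only: orth lessThan_iff)
  also have "\<dots> = (\<Sum>n<N. (a n * cnj (a n)) * of_nat N)"
    by (intro sum.cong refl) (simp add: if_distrib cong: if_cong)
  also have "\<dots> = complex_of_real (real N * (\<Sum>n<N. (cmod (a n))\<^sup>2))"
    by (simp only: complex_norm_square[symmetric] sum_distrib_left of_real_mult of_real_sum
        of_real_of_nat_eq mult.commute[of _ "of_nat N"])
  finally show ?thesis
    by (simp only: of_real_eq_iff)
qed

lemma bounded_taylor_coeff_summable:
  assumes hol: "f holomorphic_on ball 0 1" and bound: "\<And>z. z \<in> ball 0 1 \<Longrightarrow> cmod (f z) \<le> 1"
  shows "summable (\<lambda>n. (cmod (taylor_coeff f n))\<^sup>2)"
proof -
  define a where "a = taylor_coeff f"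
  have sums: "(\<lambda>n. a n * z ^ n) sums f z" if "z \<in> ball 0 1" for z
    using holomorphic_power_series[OF hol that] by (simp add: a_def taylor_coeff_def)
  have le: "(\<Sum>n<K. (cmod (a n) * r ^ n)\<^sup>2) \<le> 1" if r: "0 < r" "r < 1" for K r
  proof -
    have "summable (\<lambda>n. norm (a n * complex_of_real r ^ n))"
    proof (rule powser_insidea)
      show "summable (\<lambda>n. a n * complex_of_real ((1 + r) / 2) ^ n)"
      proof (rule sums_summable[OF sums])
        show "complex_of_real ((1 + r) / 2) \<in> ball 0 1"
          unfolding mem_ball_0 norm_of_real using r by simp
      qed
      show "norm (complex_of_real r) < norm (complex_of_real ((1 + r) / 2))"
        using r by (simp only: norm_of_real) auto
    qed
    then have S: "summable (\<lambda>n. cmod (a n) * r ^ n)"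
      using r by (simp add: norm_mult norm_power)
    define E where "E N = (\<Sum>n. cmod (a (n + N)) * r ^ (n + N))" for N
    have E: "E \<longlonglongrightarrow> 0"
      unfolding E_def by (rule suminf_exist_split2[OF S])
    have "(\<Sum>n<K. (cmod (a n) * r ^ n)\<^sup>2) \<le> (1 + E N)\<^sup>2" if N: "N \<ge> max 1 K" for N
    proof -
      have E0: "0 \<le> E N"
        unfolding E_def using r by (intro suminf_nonneg summable_ignore_initial_segment[OF S]) auto
      define c where "c n = a n * complex_of_real r ^ n" for n
      have P: "(cmod (\<Sum>n<N. c n * u ^ n))\<^sup>2 \<le> (1 + E N)\<^sup>2" if u: "cmod u = 1" for u
      proof (rule power_mono)
        have in': "complex_of_real r * u \<in> ball 0 1"
          using r u by (simp add: norm_mult)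
        have s: "(\<lambda>n. c n * u ^ n) sums f (complex_of_real r * u)"
          using sums[OF in'] by (simp add: c_def power_mult_distrib mult.assoc)
        have "f (complex_of_real r * u) = (\<Sum>n. c (n + N) * u ^ (n + N)) + (\<Sum>n<N. c n * u ^ n)"
          using suminf_split_initial_segment[OF sums_summable[OF s], of N] sums_unique[OF s] by simp
        then have "cmod (\<Sum>n<N. c n * u ^ n) \<le> cmod (f (complex_of_real r * u)) + cmod (\<Sum>n. c (n + N) * u ^ (n + N))"
          using norm_triangle_ineq4[of "f (complex_of_real r * u)" "\<Sum>n. c (n + N) * u ^ (n + N)"] by simp
        also have "cmod (\<Sum>n. c (n + N) * u ^ (n + N)) \<le> E N"
          unfolding E_def
        proof (rule norm_suminf_le)
          show "cmod (c (n + N) * u ^ (n + N)) \<le> cmod (a (n + N)) * r ^ (n + N)" for n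
            using r u by (simp add: c_def norm_mult norm_power)
          show "summable (\<lambda>n. cmod (a (n + N)) * r ^ (n + N))"
            by (rule summable_ignore_initial_segment[OF S])
        qed
        also have "cmod (f (complex_of_real r * u)) \<le> 1"
          by (rule bound[OF in'])
        finally show "cmod (\<Sum>n<N. c n * u ^ n) \<le> 1 + E N" by simp
      qed simp
      let ?w = "cis (2 * pi / real N)"
      have "real N * (\<Sum>n<N. (cmod (c n))\<^sup>2) = (\<Sum>j<N. (cmod (\<Sum>n<N. c n * (?w ^ j) ^ n))\<^sup>2)"
        using N by (intro sum_roots_unity_square[symmetric]) auto
      also have "\<dots> \<le> (\<Sum>j<N. (1 + E N)\<^sup>2)"
        by (intro sum_mono P) (simp add: norm_power)
      also have "\<dots> = real N * (1 + E N)\<^sup>2" by simp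
      finally have "(\<Sum>n<N. (cmod (c n))\<^sup>2) \<le> (1 + E N)\<^sup>2"
        using N by (simp add: mult_le_cancel_left_pos)
      moreover have "(\<Sum>n<K. (cmod (c n))\<^sup>2) \<le> (\<Sum>n<N. (cmod (c n))\<^sup>2)"
        using N by (intro sum_mono2) auto
      moreover have "(\<Sum>n<K. (cmod (c n))\<^sup>2) = (\<Sum>n<K. (cmod (a n) * r ^ n)\<^sup>2)"
        using r by (simp add: c_def norm_mult norm_power)
      ultimately show ?thesis by simp
    qed
    moreover have "(\<lambda>N. (1 + E N)\<^sup>2) \<longlonglongrightarrow> (1 + 0)\<^sup>2"
      by (intro tendsto_intros E)
    ultimately have "(\<Sum>n<K. (cmod (a n) * r ^ n)\<^sup>2) \<le> (1 + 0)\<^sup>2"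
      by (intro LIMSEQ_le_const) blast+
    then show ?thesis
      by simp
  qed
  have "(\<Sum>n<K. (cmod (a n))\<^sup>2) \<le> 1" for K
  proof (rule tendsto_upperbound)
    have "((\<lambda>r. \<Sum>n<K. (cmod (a n) * r ^ n)\<^sup>2) \<longlongrightarrow> (\<Sum>n<K. (cmod (a n) * 1 ^ n)\<^sup>2)) (at_left (1::real))"
      by (intro tendsto_intros)
    then show "((\<lambda>r. \<Sum>n<K. (cmod (a n) * r ^ n)\<^sup>2) \<longlongrightarrow> (\<Sum>n<K. (cmod (a n))\<^sup>2)) (at_left (1::real))"
      by simp
    show "\<forall>\<^sub>F r in at_left (1::real). (\<Sum>n<K. (cmod (a n) * r ^ n)\<^sup>2) \<le> 1"
      unfolding eventually_at_left_field using le by (intro exI[of _ 0]) auto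
  qed simp
  then show ?thesis
    unfolding a_def[symmetric] by (intro summableI_nonneg_bounded[where x = 1]) auto
qed

lemma comp_op_identity:
  assumes \<psi>: "analytic_selfmap \<psi>" and z: "z \<in> ball 0 1"
  shows "hardy_fun (comp_op \<psi> (shift (szego 0))) z = \<psi> z"
proof -
  define F where "F = (\<lambda>z. if z \<in> ball 0 1 then \<psi> z else 0)"
  have \<psi>_in: "\<psi> z \<in> ball 0 1" if "z \<in> ball 0 1" for z
    using \<psi> that unfolding analytic_selfmap_def by blast
  have hol: "F holomorphic_on ball 0 1"
    by (rule holomorphic_transform[of \<psi>]) (use \<psi> in \<open>auto simp: analytic_selfmap_def F_def\<close>)
  have "summable (\<lambda>n. (cmod (taylor_coeff F n))\<^sup>2)"
    by (rule bounded_taylor_coeff_summable[OF hol]) (use \<psi>_in in \<open>force simp: F_def\<close>)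
  then have "F \<in> hardy_set"
    using hol by (auto simp: hardy_set_def F_def)
  moreover have "comp_op \<psi> (shift (szego 0)) = Abs_hardy F"
    unfolding comp_op_def F_def using \<psi>_in
    by (intro arg_cong[of _ _ Abs_hardy] ext) (simp add: hardy_fun_shift hardy_fun_szego)
  ultimately show ?thesis
    using z by (simp add: Abs_hardy_inverse F_def)
qed

theorem proposition5p2:
  fixes \<phi> \<tau> \<psi> :: "complex \<Rightarrow> complex"
  assumes "analytic_selfmap \<phi>"
    and "linear_fractional \<phi>"
    and "\<not> \<phi> constant_on ball 0 1"
    and "disk_automorphism \<tau>"
    and "analytic_selfmap \<psi>"
    and "comp_op \<psi> = inv (comp_op \<tau>) \<circ> comp_op \<phi> \<circ> comp_op \<tau>"
  shows "(coposinormal (comp_op \<phi>) \<longrightarrow> coposinormal (comp_op \<psi>)) \<and>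
         (posinormal (comp_op \<phi>) \<longrightarrow> (\<exists>z\<in>ball 0 1. \<psi> z = 0) \<longrightarrow> posinormal (comp_op \<psi>))"
proof -
  obtain a b c d where "disk_lft a b c d \<phi>"
    by (rule disk_lft_of_selfmap[OF assms(1,2,3)])
  then interpret disk_lft a b c d \<phi> .
  obtain s t where st: "cmod t < cmod s"
    and \<tau>: "\<And>z. z \<in> ball 0 1 \<Longrightarrow> \<tau> z = (s * z + t) / (cnj t * z + cnj s)"
    by (rule disk_automorphism_normal_form[OF assms(4)]) blast
  interpret T: disk_lft s t "cnj t" "cnj s" \<tau>
    by (rule disk_automorphism_disk_lft[OF st \<tau>])
  have bij: "bij_betw \<tau> (ball 0 1) (ball 0 1)"
    using assms(4) by (simp add: disk_automorphism_def)
  define \<tau>' where "\<tau>' z = (cnj s * z + - t) / (cnj (- t) * z + cnj (cnj s))" for z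
  interpret T': disk_lft "cnj s" "- t" "cnj (- t)" "cnj (cnj s)" \<tau>'
    by (rule disk_automorphism_disk_lft) (use st in \<open>auto simp: \<tau>'_def\<close>)
  have \<tau>'_\<tau>: "\<tau>' (\<tau> z) = z" if z: "z \<in> ball 0 1" for z
  proof -
    have "(cnj t * z + cnj s) * (cnj s * \<tau> z + - t) = (s * cnj s - t * cnj t) * z"
      and "(cnj t * z + cnj s) * (cnj (- t) * \<tau> z + cnj (cnj s)) = s * cnj s - t * cnj t"
      using T.den[OF z] by (simp_all add: \<tau>[OF z] field_simps)
    then have "\<tau>' (\<tau> z) = ((s * cnj s - t * cnj t) * z) / (s * cnj s - t * cnj t)"
      unfolding \<tau>'_def using T.den[OF z] by (metis mult_divide_mult_cancel_left)
    then show ?thesis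
      using T.det by simp
  qed
  have \<tau>_\<tau>': "\<tau> (\<tau>' z) = z" if z: "z \<in> ball 0 1" for z
  proof -
    have "z \<in> \<tau> ` ball 0 1"
      using bij_betw_imp_surj_on[OF bij] z by simp
    then obtain y where y: "y \<in> ball 0 1" "z = \<tau> y"
      by blast
    show ?thesis
      unfolding y(2) \<tau>'_\<tau>[OF y(1)] ..
  qed
  obtain a' b' c' d' where L: "disk_lft a' b' c' d' (\<tau> \<circ> \<phi> \<circ> \<tau>')"
    and \<sigma>': "\<And>z. z \<in> ball 0 1 \<Longrightarrow> disk_lft.\<sigma> a' b' c' d' (\<tau> z) = \<tau> (\<sigma> z)"
    using conjugate_disk_lft[OF st \<tau>] T'.\<phi>_in \<tau>_\<tau>' by blast
  interpret P: disk_lft a' b' c' d' "\<tau> \<circ> \<phi> \<circ> \<tau>'"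
    by (rule L)
  have inv_right: "comp_op \<tau> (comp_op \<tau>' f) = f" and inv_left: "comp_op \<tau>' (comp_op \<tau> f) = f" for f
    by (rule hardy_fun_eqI;
        simp add: T.hardy_fun_comp_op T'.hardy_fun_comp_op \<tau>'_\<tau> \<tau>_\<tau>' T.\<phi>_in T'.\<phi>_in del: mem_ball_0 mem_ball)+
  have "inv (comp_op \<tau>) = comp_op \<tau>'"
    by (rule inv_equality) (rule inv_left, rule inv_right)
  then have conj: "comp_op \<psi> = comp_op (\<tau> \<circ> \<phi> \<circ> \<tau>')"
    unfolding assms(6)
    by (intro ext hardy_fun_eqI)
      (simp add: P.hardy_fun_comp_op hardy_fun_comp_op T.hardy_fun_comp_op T'.hardy_fun_comp_op
        \<phi>_in T'.\<phi>_in del: mem_ball_0 mem_ball)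
  have \<psi>: "\<psi> z = (\<tau> \<circ> \<phi> \<circ> \<tau>') z" if z: "z \<in> ball 0 1" for z
  proof -
    have "\<psi> z = hardy_fun (comp_op (\<tau> \<circ> \<phi> \<circ> \<tau>') (shift (szego 0))) z"
      unfolding conj[symmetric] by (rule comp_op_identity[OF assms(5) z, symmetric])
    also have "\<dots> = (\<tau> \<circ> \<phi> \<circ> \<tau>') z"
      using P.\<phi>_in[OF z] by (simp add: P.hardy_fun_comp_op[OF z] hardy_fun_shift hardy_fun_szego)
    finally show ?thesis .
  qed
  have \<tau>_img: "\<tau> ` ball 0 1 = ball 0 1" and \<tau>'_img: "\<tau>' ` ball 0 1 = ball 0 1"
    using bij_betw_imp_surj_on[OF bij] T'.\<phi>_in \<tau>'_\<tau> T.\<phi>_in by (blast, force)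
  have \<psi>_img: "(\<tau> \<circ> \<phi> \<circ> \<tau>') ` ball 0 1 = \<tau> ` \<phi> ` ball 0 1"
    by (simp only: image_comp[symmetric] \<tau>'_img)
  have \<sigma>_img: "P.\<sigma> ` ball 0 1 = \<tau> ` \<sigma> ` ball 0 1"
  proof -
    have "P.\<sigma> ` ball 0 1 = P.\<sigma> ` \<tau> ` ball 0 1"
      by (simp only: \<tau>_img)
    also have "\<dots> = \<tau> ` \<sigma> ` ball 0 1"
      unfolding image_image using \<sigma>' by (rule image_cong[OF refl])
    finally show ?thesis .
  qed
  show ?thesis
    unfolding conj
  proof (intro conjI impI)
    assume "coposinormal (comp_op \<phi>)"
    then show "coposinormal (comp_op (\<tau> \<circ> \<phi> \<circ> \<tau>'))"
      by (intro P.image_subset_imp_coposinormal)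
        (simp only: \<psi>_img \<sigma>_img coposinormal_imp_image_subset image_mono)
  next
    assume "posinormal (comp_op \<phi>)" and "\<exists>z\<in>ball 0 1. \<psi> z = 0"
    then obtain z0 where "z0 \<in> ball 0 1" "(\<tau> \<circ> \<phi> \<circ> \<tau>') z0 = 0"
      using \<psi> by auto
    with \<open>posinormal (comp_op \<phi>)\<close> show "posinormal (comp_op (\<tau> \<circ> \<phi> \<circ> \<tau>'))"
      by (intro P.image_subset_imp_posinormal)
        (simp_all only: \<psi>_img \<sigma>_img posinormal_imp_image_subset image_mono)
  qed
qed

end
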